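(* Let $\ell_1,\ell_2>0$ with $\ell_1\neq\ell_2$. Then the $x$-projection to the plane $\mathbb{R}^2$ of any singular curve of ${\mathcal D}$ in ${\mathcal C}$ is an elastic curve.
   Context: 2-linkage: a triple of points $x,m_1,m_2\in\mathbb{R}^2$ with $|xm_1|=\ell_1$, $|xm_2|=\ell_2$ fixed. Coordinates: $x=(x_1,x_2)$ and the directions $\alpha_1,\alpha_2\in\mathbb{R}/2\pi\mathbb{Z}$ of the oriented segments $m_1x$, $m_2x$, so $m_i=x-\ell_i(\cos\alpha_i,\sin\alpha_i)$. For $\ell_1\ne\ell_2$ the configuration space is ${\mathcal C}=\mathbb{R}^2\times T^2$. The distribution ${\mathcal D}$ (no-slip condition: the velocity of $m_i$ is parallel to the segment $m_ix$, $i=1,2$) is spanned by $v_1=\partial_{x_1}-\frac{\sin\alpha_1}{\ell_1}\partial_{\alpha_1}-\frac{\sin\alpha_2}{\ell_2}\partial_{\alpha_2}$ and $v_2=\partial_{x_2}+\frac{\cos\alpha_1}{\ell_1}\partial_{\alpha_1}+\frac{\cos\alpha_2}{\ell_2}\partial_{\alpha_2}$. The singular curves of ${\mathcal D}$ (regular horizontal curves, up to reparametrization, that are critical points of the endpoint map) are the integral curves of $\xi=\left(\frac{\sin\alpha_1}{\ell_1}-\frac{\sin\alpha_2}{\ell_2}\right)v_1-\left(\frac{\cos\alpha_1}{\ell_1}-\frac{\cos\alpha_2}{\ell_2}\right)v_2$. The $x$-projection is the map $(x_1,x_2,\alpha_1,\alpha_2)\mapsto(x_1,x_2)$. An elastic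 curve (elastica) is a planar curve whose curvature $\kappa$, as a function of arc length, satisfies $\kappa''+\frac12\kappa^3+A\kappa=0$ for some constant $A$. *)

theory Defs
  imports "HOL-Analysis.Analysis"
begin

text \<open>The configuration space is the product of the plane and a torus, with the circle of
  directions realised as the unit circle of the complex plane. Vector fields are written in the
  coordinates (x1, x2, al1, al2); the angles are real numbers, and passing to them from the circle
  is a local diffeomorphism.\<close>

type_synonym coords = "real \<times> real \<times> real \<times> real"
type_synonym config = "(real \<times> real) \<times> complex \<times> complex"

definition config_space :: "config set" where
  "config_space = UNIV \<times> sphere 0 1 \<times> sphere 0 1"

definition of_coords :: "coords \<Rightarrow> config" where
  "of_coords = (\<lambda>(x1, x2, al1, al2). ((x1, x2), cis al1, cis al2))"

definition x_proj :: "config \<Rightarrow> real \<times> real" where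
  "x_proj = fst"

definition v1 :: "real \<Rightarrow> real \<Rightarrow> coords \<Rightarrow> coords" where
  "v1 l1 l2 = (\<lambda>(x1, x2, al1, al2). (1, 0, - sin al1 / l1, - sin al2 / l2))"

definition v2 :: "real \<Rightarrow> real \<Rightarrow> coords \<Rightarrow> coords" where
  "v2 l1 l2 = (\<lambda>(x1, x2, al1, al2). (0, 1, cos al1 / l1, cos al2 / l2))"

definition distr :: "real \<Rightarrow> real \<Rightarrow> coords \<Rightarrow> coords set" where
  "distr l1 l2 q = span {v1 l1 l2 q, v2 l1 l2 q}"

text \<open>Curves of class C1 with nowhere vanishing velocity in the distribution; derivatives at
  endpoints belonging to \<open>I\<close> are one-sided.\<close>

definition regular_horizontal :: "real \<Rightarrow> real \<Rightarrow> real set \<Rightarrow> (real \<Rightarrow> coords) \<Rightarrow> bool" where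
  "regular_horizontal l1 l2 I q \<longleftrightarrow>
    (\<exists>q'. continuous_on I q' \<and>
      (\<forall>t\<in>I. (q has_vector_derivative q' t) (at t within I) \<and>
              q' t \<noteq> 0 \<and> q' t \<in> distr l1 l2 (q t)))"

text \<open>Since v1, v2 is a global frame, the horizontal curves on \<open>[a, b]\<close> starting at a given point
  correspond to their controls (u1, u2), the components of the velocity in the frame. Controls
  are taken from the Banach space of bounded continuous maps on the real line, of which only the
  restriction to \<open>[a, b]\<close> matters.\<close>

definition trajectory ::
    "real \<Rightarrow> real \<Rightarrow> real \<Rightarrow> real \<Rightarrow> (real \<Rightarrow>\<^sub>C (real \<times> real)) \<Rightarrow> (real \<Rightarrow> coords) \<Rightarrow> bool" where
  "trajectory l1 l2 a b u q \<longleftrightarrow>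
    (\<forall>t\<in>{a..b}. (q has_vector_derivative
        fst (apply_bcontfun u t) *\<^sub>R v1 l1 l2 (q t) + snd (apply_bcontfun u t) *\<^sub>R v2 l1 l2 (q t))
      (at t within {a..b}))"

text \<open>The trajectory with given control and initial point exists and is unique, the coefficients
  of v1 and v2 being bounded and Lipschitz.\<close>

definition endpoint_map ::
    "real \<Rightarrow> real \<Rightarrow> real \<Rightarrow> real \<Rightarrow> coords \<Rightarrow> (real \<Rightarrow>\<^sub>C (real \<times> real)) \<Rightarrow> coords" where
  "endpoint_map l1 l2 a b q0 u = (THE p. \<exists>q. trajectory l1 l2 a b u q \<and> q a = q0 \<and> q b = p)"

definition critical_arc :: "real \<Rightarrow> real \<Rightarrow> real \<Rightarrow> real \<Rightarrow> (real \<Rightarrow> coords) \<Rightarrow> bool" where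
  "critical_arc l1 l2 a b q \<longleftrightarrow>
    (\<exists>u D. trajectory l1 l2 a b u q \<and>
      (endpoint_map l1 l2 a b (q a) has_derivative D) (at u) \<and> \<not> surj D)"

text \<open>The endpoint map is defined on curves over a compact interval. A curve over an arbitrary
  interval \<open>I\<close> (for instance the whole line) is singular if \<open>I\<close> is exhausted by compact intervals
  on which the curve is critical; for \<open>I = {a..b}\<close> with \<open>a < b\<close>
  this amounts to criticality on \<open>[a, b]\<close> itself.\<close>

definition singular_curve :: "real \<Rightarrow> real \<Rightarrow> real set \<Rightarrow> (real \<Rightarrow> config) \<Rightarrow> bool" where
  "singular_curve l1 l2 I c \<longleftrightarrow>
    (\<exists>q. (\<forall>t\<in>I. c t = of_coords (q t)) \<and> regular_horizontal l1 l2 I q \<and>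
      (\<forall>s\<in>I. \<forall>t\<in>I. s < t \<longrightarrow>
        (\<exists>a\<in>I. \<exists>b\<in>I. a \<le> s \<and> t \<le> b \<and> critical_arc l1 l2 a b q)))"

definition rot90 :: "real \<times> real \<Rightarrow> real \<times> real" where
  "rot90 = (\<lambda>(a, b). (- b, a))"

text \<open>Frenet equation of a planar unit speed curve with signed curvature \<open>k\<close>.\<close>

definition unit_speed_curvature ::
    "real set \<Rightarrow> (real \<Rightarrow> real \<times> real) \<Rightarrow> (real \<Rightarrow> real) \<Rightarrow> bool" where
  "unit_speed_curvature J y k \<longleftrightarrow>
    (\<exists>T. \<forall>s\<in>J. (y has_vector_derivative T s) (at s within J) \<and> norm (T s) = 1 \<and>
                (T has_vector_derivative k s *\<^sub>R rot90 (T s)) (at s within J))"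

definition arc_length_reparam ::
    "real set \<Rightarrow> (real \<Rightarrow> real \<times> real) \<Rightarrow> (real \<Rightarrow> real) \<Rightarrow> (real \<Rightarrow> real \<times> real) \<Rightarrow> bool" where
  "arc_length_reparam I c \<sigma> y \<longleftrightarrow>
    (\<forall>t\<in>I. c t = y (\<sigma> t) \<and>
      (\<exists>v. v \<noteq> 0 \<and> (c has_vector_derivative v) (at t within I) \<and>
           (\<sigma> has_real_derivative norm v) (at t within I)))"

definition elastic_curve :: "real set \<Rightarrow> (real \<Rightarrow> real \<times> real) \<Rightarrow> bool" where
  "elastic_curve I c \<longleftrightarrow>
    (\<exists>\<sigma> y k k' k'' A. arc_length_reparam I c \<sigma> y \<and> unit_speed_curvature (\<sigma> ` I) y k \<and>
      (\<forall>s\<in>\<sigma> ` I. (k has_real_derivative k' s) (at s within \<sigma> ` I) \<and>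
                  (k' has_real_derivative k'' s) (at s within \<sigma> ` I) \<and>
                  k'' s + 1 / 2 * k s ^ 3 + A * k s = 0))"

end

theory Submission
  imports Defs
begin

text \<open>The position of the hitch is the integral of its velocity \<open>u\<close>, and each of the two angles solves a scalar
equation that involves only \<open>u\<close> and that angle. The linearised equations are therefore scalar as well, and the derivative
of the endpoint map is an explicit integral (\<open>endpoint_derivative\<close>). This rests on the existence and
uniqueness of solutions of the scalar equation and on a second order estimate of their dependence on the
control (\<open>lipschitz_ode_solution\<close>, \<open>steering_variation\<close>).

If the derivative is not surjective, a covector annihilates its range. Testing it on the control that is its own
coefficient function yields multipliers \<open>\<mu>1\<close>, \<open>\<mu>2\<close> along the arc, never both zero, for which
\<open>(\<mu>1 / l1) e1 + (\<mu>2 / l2) e2\<close> is constant, \<open>e1\<close> and \<open>e2\<close> being the unit vectors in the directions of the two segments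
(\<open>critical_arc_multipliers\<close>). Differentiating this identity twice shows that \<open>u\<close> has the same component,
divided by the length, along both segments, so that \<open>u\<close> is orthogonal to \<open>e1 / l1 - e2 / l2\<close>
(\<open>critical_arc_drag_eq\<close>).

This orthogonality determines the tangent line in terms of the two angles. Parametrised by arc length, the
curvature is the sum of the two angular velocities, and the equation of elastic curves with
\<open>A = - (1 / l1\<^sup>2 + 1 / l2\<^sup>2) / 2\<close> follows by two differentiations (\<open>elastic_of_equal_drag\<close>).\<close>

section \<open>Ordinary differential equations with a Lipschitz right-hand side\<close>

text \<open>A Gronwall estimate. Working with the square of \<open>w\<close> avoids differentiating an absolute value:
\<open>w\<^sup>2 + M\<^sup>2\<close> multiplied by a decaying exponential is nonincreasing.\<close>

lemma gronwall_from_zero: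
  fixes w w' :: "real \<Rightarrow> real"
  assumes "a \<le> b" "w a = 0" "L \<ge> 0" "M \<ge> 0"
    and der: "\<And>t. t \<in> {a..b} \<Longrightarrow> (w has_real_derivative w' t) (at t within {a..b})"
    and bound: "\<And>t. t \<in> {a..b} \<Longrightarrow> \<bar>w' t\<bar> \<le> L * \<bar>w t\<bar> + M"
    and t: "t \<in> {a..b}"
  shows "\<bar>w t\<bar> \<le> M * exp ((L + 1) * (b - a))"
proof -
  define K where "K = L + 1"
  define g where "g = (\<lambda>s. exp (- 2 * K * (s - a)) * ((w s)\<^sup>2 + M\<^sup>2))"
  define g' where "g' = (\<lambda>s. exp (- 2 * K * (s - a)) * (2 * w s * w' s - 2 * K * ((w s)\<^sup>2 + M\<^sup>2)))"
  have g_der: "(g has_real_derivative g' s) (at s within {a..b})" if "s \<in> {a..b}" for s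
    unfolding g_def g'_def
    by (auto intro!: derivative_eq_intros der that simp: algebra_simps)
  have g'_nonpos: "g' s \<le> 0" if "s \<in> {a..b}" for s
  proof -
    have "w s * w' s \<le> \<bar>w s\<bar> * \<bar>w' s\<bar>"
      by (metis abs_ge_self abs_mult)
    also have "\<dots> \<le> \<bar>w s\<bar> * (L * \<bar>w s\<bar> + M)"
      using bound[OF that] by (intro mult_left_mono) auto
    finally have "2 * (w s * w' s) \<le> 2 * L * (w s)\<^sup>2 + 2 * (\<bar>w s\<bar> * M)"
      by (simp add: algebra_simps power2_eq_square)
    \<comment> \<open>The mixed term is absorbed by the two squares; this is where the rate \<open>L + 1\<close> comes from.\<close>
    moreover have "2 * (\<bar>w s\<bar> * M) \<le> (w s)\<^sup>2 + M\<^sup>2"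
      using sum_squares_bound[of "\<bar>w s\<bar>" M] by simp
    moreover have "0 \<le> L * M\<^sup>2" "0 \<le> (w s)\<^sup>2" "0 \<le> M\<^sup>2"
      using \<open>L \<ge> 0\<close> by auto
    moreover have "2 * w s * w' s - 2 * K * ((w s)\<^sup>2 + M\<^sup>2)
        = 2 * (w s * w' s) - 2 * L * (w s)\<^sup>2 - 2 * (L * M\<^sup>2) - 2 * (w s)\<^sup>2 - 2 * M\<^sup>2"
      by (simp add: K_def algebra_simps)
    ultimately have "2 * w s * w' s - 2 * K * ((w s)\<^sup>2 + M\<^sup>2) \<le> 0"
      by linarith
    then show ?thesis
      unfolding g'_def by (simp add: mult_nonneg_nonpos)
  qed
  have "g t \<le> g a"
  proof (rule DERIV_nonpos_imp_decreasing_open[where f = g])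
    show "a \<le> t" using t by simp
    show "\<exists>y. DERIV g s :> y \<and> y \<le> 0" if "a < s" "s < t" for s
      using g_der[of s] g'_nonpos[of s] at_within_Icc_at[of a s b] that t by auto
    show "continuous_on {a..t} g"
      using g_der t
      by (meson DERIV_continuous atLeastAtMost_iff atLeastatMost_subset_iff
          continuous_on_eq_continuous_within continuous_on_subset order_refl)
  qed
  then have "exp (2 * K * (t - a)) * g t \<le> exp (2 * K * (t - a)) * g a"
    by (rule mult_left_mono) simp
  moreover have "g a = M\<^sup>2"
    using \<open>w a = 0\<close> by (simp add: g_def)
  moreover have "exp (2 * K * (t - a)) * g t = (w t)\<^sup>2 + M\<^sup>2"
    unfolding g_def by (simp flip: exp_add mult.assoc)
  ultimately have "(w t)\<^sup>2 + M\<^sup>2 \<le> M\<^sup>2 * exp (2 * K * (t - a))"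
    by (metis mult.commute)
  also have "\<dots> = (M * exp (K * (t - a)))\<^sup>2"
    by (simp add: power_mult_distrib flip: exp_double)
  finally have "(w t)\<^sup>2 \<le> (M * exp (K * (t - a)))\<^sup>2"
    by (smt (verit) zero_le_power2)
  then have "\<bar>w t\<bar> \<le> M * exp (K * (t - a))"
    using \<open>M \<ge> 0\<close> by (simp add: abs_mult flip: abs_le_square_iff)
  also have "\<dots> \<le> M * exp (K * (b - a))"
    using \<open>M \<ge> 0\<close> \<open>L \<ge> 0\<close> t by (auto intro!: mult_left_mono simp: K_def)
  finally show ?thesis unfolding K_def .
qed

text \<open>The Picard operator on bounded continuous functions, conjugated with the weight
\<open>exp (K * (t - a))\<close> for \<open>K = \<bar>L\<bar> + 1\<close>, contracts by the factor \<open>\<bar>L\<bar> / K < 1\<close>. Thanks to the weight one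
application of the fixed point theorem covers the whole interval, whatever its length. Outside the
interval the functions are continued as constants.\<close>

lemma lipschitz_ode_solution:
  fixes F :: "real \<Rightarrow> 'a::banach \<Rightarrow> 'a"
  assumes "a \<le> b"
    and cont: "continuous_on ({a..b} \<times> UNIV) (\<lambda>(t, x). F t x)"
    and lip: "\<And>t x y. t \<in> {a..b} \<Longrightarrow> norm (F t x - F t y) \<le> L * norm (x - y)"
  obtains \<phi> where "\<phi> a = x0"
    "\<And>t. t \<in> {a..b} \<Longrightarrow> (\<phi> has_vector_derivative F t (\<phi> t)) (at t within {a..b})"
proof -
  define K where "K = \<bar>L\<bar> + 1"
  have "K > 0" by (simp add: K_def)
  define G where "G = (\<lambda>(\<psi> :: real \<Rightarrow>\<^sub>C 'a) r. F r (exp (K * (r - a)) *\<^sub>R \<psi> r))"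
  define Pic where "Pic = (\<lambda>\<psi> t. exp (- K * (t - a)) *\<^sub>R (x0 + integral {a..t} (G \<psi>)))"
  have G_cont: "continuous_on {a..b} (G \<psi>)" for \<psi>
  proof -
    have "continuous_on {a..b} (\<lambda>r. (\<lambda>(t, x). F t x) (r, exp (K * (r - a)) *\<^sub>R \<psi> r))"
      by (rule continuous_on_compose2[OF cont]) (auto intro!: continuous_intros)
    then show ?thesis by (simp add: G_def)
  qed
  have Pic_cont: "continuous_on {a..b} (Pic \<psi>)" for \<psi>
    unfolding Pic_def
    by (intro continuous_intros indefinite_integral_continuous_1 integrable_continuous_real G_cont)
  have "\<exists>g :: real \<Rightarrow>\<^sub>C 'a. (\<forall>t. g t = Pic \<psi> (clamp a b t))" for \<psi>
    using continuous_on_cbox_bcontfunE[of a b "Pic \<psi>"] Pic_cont[of \<psi>] by (metis cbox_interval)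
  then obtain \<Phi> :: "(real \<Rightarrow>\<^sub>C 'a) \<Rightarrow> (real \<Rightarrow>\<^sub>C 'a)"
    where \<Phi>: "\<And>\<psi> t. \<Phi> \<psi> t = Pic \<psi> (clamp a b t)"
    by metis
  have contraction: "dist (\<Phi> \<psi>) (\<Phi> \<eta>) \<le> \<bar>L\<bar> / K * dist \<psi> \<eta>" for \<psi> \<eta>
  proof (rule dist_bound)
    fix t'
    define t where "t = clamp a b t'"
    define d where "d = dist \<psi> \<eta>"
    have t: "t \<in> {a..b}"
      using clamp_in_interval[of a b t'] \<open>a \<le> b\<close> by (simp add: t_def)
    have int: "G \<theta> integrable_on {a..t}" for \<theta>
      using G_cont[of \<theta>] t by (auto intro!: integrable_continuous_real elim: continuous_on_subset)
    have weight: "((\<lambda>r. \<bar>L\<bar> * exp (K * (r - a)) * d) has_integral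
        \<bar>L\<bar> / K * (exp (K * (t - a)) - 1) * d) {a..t}"
    proof -
      have "((\<lambda>r. \<bar>L\<bar> * exp (K * (r - a)) * d) has_integral
          \<bar>L\<bar> / K * exp (K * (t - a)) * d - \<bar>L\<bar> / K * exp (K * (a - a)) * d) {a..t}"
        using t \<open>K > 0\<close>
        by (intro fundamental_theorem_of_calculus)
          (auto intro!: derivative_eq_intros
            simp flip: has_real_derivative_iff_has_vector_derivative)
      then show ?thesis by (simp add: algebra_simps)
    qed
    have "norm (integral {a..t} (G \<psi>) - integral {a..t} (G \<eta>))
        = norm (integral {a..t} (\<lambda>r. G \<psi> r - G \<eta> r))"
      using int by (simp add: integral_diff)
    also have "\<dots> \<le> integral {a..t} (\<lambda>r. \<bar>L\<bar> * exp (K * (r - a)) * d)"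
    proof (rule integral_norm_bound_integral)
      show "(\<lambda>r. G \<psi> r - G \<eta> r) integrable_on {a..t}"
        using int by (intro integrable_diff)
      show "(\<lambda>r. \<bar>L\<bar> * exp (K * (r - a)) * d) integrable_on {a..t}"
        using weight by blast
      fix r assume "r \<in> {a..t}"
      then have "norm (G \<psi> r - G \<eta> r)
          \<le> L * norm (exp (K * (r - a)) *\<^sub>R \<psi> r - exp (K * (r - a)) *\<^sub>R \<eta> r)"
        unfolding G_def using t by (intro lip) auto
      also have "\<dots> = L * (exp (K * (r - a)) * dist (\<psi> r) (\<eta> r))"
        by (simp add: dist_norm flip: scaleR_diff_right)
      also have "\<dots> \<le> \<bar>L\<bar> * (exp (K * (r - a)) * d)"
        unfolding d_def by (intro mult_mono) (auto simp: dist_bounded)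
      finally show "norm (G \<psi> r - G \<eta> r) \<le> \<bar>L\<bar> * exp (K * (r - a)) * d"
        by (simp add: mult.assoc)
    qed
    also have "\<dots> = \<bar>L\<bar> / K * (exp (K * (t - a)) - 1) * d"
      using weight by (rule integral_unique)
    finally have "exp (- K * (t - a)) * norm (integral {a..t} (G \<psi>) - integral {a..t} (G \<eta>))
        \<le> exp (- K * (t - a)) * (\<bar>L\<bar> / K * (exp (K * (t - a)) - 1) * d)"
      by (rule mult_left_mono) simp
    also have "\<dots> = \<bar>L\<bar> / K * d * (1 - exp (- K * (t - a)))"
    proof -
      have "exp (- K * (t - a)) * exp (K * (t - a)) = 1"
        by (simp flip: exp_add)
      then show ?thesis by algebra
    qed
    also have "\<dots> \<le> \<bar>L\<bar> / K * d * 1"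
      using \<open>K > 0\<close> by (intro mult_left_mono) (auto simp: d_def)
    finally show "dist (\<Phi> \<psi> t') (\<Phi> \<eta> t') \<le> \<bar>L\<bar> / K * dist \<psi> \<eta>"
      by (simp add: \<Phi> Pic_def dist_norm t_def d_def flip: scaleR_diff_right)
  qed
  have "\<exists>!\<psi>. \<Phi> \<psi> = \<psi>"
    using contraction by (intro banach_fix_type[of "\<bar>L\<bar> / K"]) (auto simp: K_def)
  then obtain \<psi> where "\<Phi> \<psi> = \<psi>" by blast
  then have fixpoint: "\<psi> t = Pic \<psi> t" if "t \<in> {a..b}" for t
    using \<Phi>[of \<psi> t] that by simp
  define \<phi> where "\<phi> = (\<lambda>t. x0 + integral {a..t} (G \<psi>))"
  have G_eq: "G \<psi> t = F t (\<phi> t)" if "t \<in> {a..b}" for t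
    unfolding G_def fixpoint[OF that] Pic_def \<phi>_def by (simp flip: exp_add)
  show thesis
  proof (rule that[of \<phi>])
    show "\<phi> a = x0" by (simp add: \<phi>_def)
    show "(\<phi> has_vector_derivative F t (\<phi> t)) (at t within {a..b})" if "t \<in> {a..b}" for t
      using integral_has_vector_derivative[OF G_cont that, of \<psi>]
      unfolding G_eq[OF that] unfolding \<phi>_def
      by (auto intro!: derivative_eq_intros)
  qed
qed

section \<open>The equation of one angle\<close>

text \<open>Seen from a wheel at distance \<open>l\<close> behind the hitch, in the direction \<open>\<theta>\<close>, the velocity \<open>u\<close> of the hitch has
a component orthogonal to the segment and one along it. Divided by \<open>l\<close>, the first is the angular
velocity forced by the no-slip condition. The second, divided by \<open>l\<close>, is minus the derivative of the
first with respect to \<open>\<theta>\<close>, so it governs the linearised and the adjoint equations.\<close>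

definition steer :: "real \<Rightarrow> real \<times> real \<Rightarrow> real \<Rightarrow> real" where
  "steer l u \<theta> = (- sin \<theta> * fst u + cos \<theta> * snd u) / l"

definition drag :: "real \<Rightarrow> real \<times> real \<Rightarrow> real \<Rightarrow> real" where
  "drag l u \<theta> = (cos \<theta> * fst u + sin \<theta> * snd u) / l"

lemma steer_add_control: "steer l (u + \<epsilon> *\<^sub>R h) \<theta> = steer l u \<theta> + \<epsilon> * steer l h \<theta>"
  by (simp add: steer_def algebra_simps add_divide_distrib diff_divide_distrib)

lemma abs_sin_diff_le: "\<bar>sin x - sin y\<bar> \<le> \<bar>x - y\<bar>" for x y :: real
proof -
  have "\<bar>sin x - sin y\<bar> = 2 * \<bar>sin ((x - y) / 2)\<bar> * \<bar>cos ((x + y) / 2)\<bar>"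
    by (simp add: sin_diff_sin abs_mult)
  also have "\<dots> \<le> 2 * \<bar>(x - y) / 2\<bar> * 1"
    using abs_sin_x_le_abs_x[of "(x - y) / 2"] by (intro mult_mono) auto
  finally show ?thesis by simp
qed

lemma abs_cos_diff_le: "\<bar>cos x - cos y\<bar> \<le> \<bar>x - y\<bar>" for x y :: real
  using abs_sin_diff_le[of "x + pi / 2" "y + pi / 2"] by (simp add: sin_add)

lemma abs_sin_taylor_le: "\<bar>sin (x + w) - sin x - w * cos x\<bar> \<le> w\<^sup>2" for x w :: real
proof -
  have "\<exists>\<xi>. \<bar>\<xi>\<bar> \<le> \<bar>w\<bar> \<and> sin (x + w) - sin x = w * cos (x + \<xi>)"
  proof (cases w "0 :: real" rule: linorder_cases)
    case less
    then obtain \<xi> where "x + w < \<xi>" "\<xi> < x" "sin x - sin (x + w) = (x - (x + w)) * cos \<xi>"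
      using MVT2[of "x + w" x sin cos] by (auto intro: DERIV_sin)
    then show ?thesis by (intro exI[of _ "\<xi> - x"]) auto
  next
    case greater
    then obtain \<xi> where "x < \<xi>" "\<xi> < x + w" "sin (x + w) - sin x = (x + w - x) * cos \<xi>"
      using MVT2[of x "x + w" sin cos] by (auto intro: DERIV_sin)
    then show ?thesis by (intro exI[of _ "\<xi> - x"]) auto
  qed auto
  then obtain \<xi> where \<xi>: "\<bar>\<xi>\<bar> \<le> \<bar>w\<bar>" "sin (x + w) - sin x = w * cos (x + \<xi>)"
    by blast
  then have "\<bar>sin (x + w) - sin x - w * cos x\<bar> = \<bar>w\<bar> * \<bar>cos (x + \<xi>) - cos x\<bar>"
    by (simp add: abs_mult flip: right_diff_distrib)
  also have "\<dots> \<le> \<bar>w\<bar> * \<bar>w\<bar>"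
    using abs_cos_diff_le[of "x + \<xi>" x] \<xi> by (intro mult_left_mono) auto
  finally show ?thesis by (simp add: power2_eq_square)
qed

lemma abs_cos_taylor_le: "\<bar>cos (x + w) - cos x + w * sin x\<bar> \<le> w\<^sup>2" for x w :: real
  using abs_sin_taylor_le[of "x + pi / 2" w] by (simp add: sin_add cos_add algebra_simps)

context
  fixes l :: real
  assumes l: "l > 0"
begin

lemma abs_steer_le: "\<bar>steer l u \<theta>\<bar> \<le> 2 * norm u / l"
proof -
  have "\<bar>- sin \<theta> * fst u + cos \<theta> * snd u\<bar> \<le> \<bar>sin \<theta>\<bar> * \<bar>fst u\<bar> + \<bar>cos \<theta>\<bar> * \<bar>snd u\<bar>"
    by (metis abs_minus_cancel abs_mult abs_triangle_ineq)
  also have "\<dots> \<le> 1 * norm u + 1 * norm u"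
    using norm_fst_le[of "fst u" "snd u"] norm_snd_le[of "snd u" "fst u"]
    by (intro add_mono mult_mono) auto
  finally show ?thesis using l by (simp add: steer_def abs_divide divide_right_mono)
qed

lemma abs_steer_diff_le: "\<bar>steer l u \<theta> - steer l u \<eta>\<bar> \<le> 2 * norm u / l * \<bar>\<theta> - \<eta>\<bar>"
proof -
  have "\<bar>(cos \<theta> - cos \<eta>) * snd u - (sin \<theta> - sin \<eta>) * fst u\<bar>
      \<le> \<bar>cos \<theta> - cos \<eta>\<bar> * \<bar>snd u\<bar> + \<bar>sin \<theta> - sin \<eta>\<bar> * \<bar>fst u\<bar>"
    by (metis abs_mult abs_triangle_ineq4)
  also have "\<dots> \<le> \<bar>\<theta> - \<eta>\<bar> * norm u + \<bar>\<theta> - \<eta>\<bar> * norm u"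
    using norm_fst_le[of "fst u" "snd u"] norm_snd_le[of "snd u" "fst u"]
    by (intro add_mono mult_mono abs_sin_diff_le abs_cos_diff_le) auto
  finally have "\<bar>((cos \<theta> - cos \<eta>) * snd u - (sin \<theta> - sin \<eta>) * fst u) / l\<bar>
      \<le> (\<bar>\<theta> - \<eta>\<bar> * norm u + \<bar>\<theta> - \<eta>\<bar> * norm u) / l"
    using l by (simp add: abs_divide divide_right_mono)
  then show ?thesis
    by (simp add: steer_def algebra_simps flip: diff_divide_distrib)
qed

lemma abs_steer_taylor_le:
  "\<bar>steer l u (\<theta> + w) - steer l u \<theta> + w * drag l u \<theta>\<bar> \<le> 2 * norm u / l * w\<^sup>2"
proof -
  have "\<bar>(cos (\<theta> + w) - cos \<theta> + w * sin \<theta>) * snd u - (sin (\<theta> + w) - sin \<theta> - w * cos \<theta>) * fst u\<bar>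
      \<le> \<bar>cos (\<theta> + w) - cos \<theta> + w * sin \<theta>\<bar> * \<bar>snd u\<bar>
        + \<bar>sin (\<theta> + w) - sin \<theta> - w * cos \<theta>\<bar> * \<bar>fst u\<bar>"
    by (metis abs_mult abs_triangle_ineq4)
  also have "\<dots> \<le> w\<^sup>2 * norm u + w\<^sup>2 * norm u"
    using norm_fst_le[of "fst u" "snd u"] norm_snd_le[of "snd u" "fst u"]
    by (intro add_mono mult_mono abs_sin_taylor_le abs_cos_taylor_le) auto
  finally have "\<bar>((cos (\<theta> + w) - cos \<theta> + w * sin \<theta>) * snd u
        - (sin (\<theta> + w) - sin \<theta> - w * cos \<theta>) * fst u) / l\<bar>
      \<le> (w\<^sup>2 * norm u + w\<^sup>2 * norm u) / l"
    using l by (simp add: abs_divide divide_right_mono)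
  moreover have "((cos (\<theta> + w) - cos \<theta> + w * sin \<theta>) * snd u
        - (sin (\<theta> + w) - sin \<theta> - w * cos \<theta>) * fst u) / l
      = steer l u (\<theta> + w) - steer l u \<theta> + w * drag l u \<theta>"
    using l by (simp add: steer_def drag_def field_simps)
  ultimately show ?thesis
    by (simp add: mult.assoc)
qed

end

definition solves_steering ::
    "real \<Rightarrow> real \<Rightarrow> real \<Rightarrow> (real \<Rightarrow> real \<times> real) \<Rightarrow> (real \<Rightarrow> real) \<Rightarrow> bool" where
  "solves_steering l a b u \<theta> \<longleftrightarrow>
    (\<forall>t\<in>{a..b}. (\<theta> has_real_derivative steer l (u t) (\<theta> t)) (at t within {a..b}))"

lemma steering_solution:
  assumes "l > 0" "a \<le> b" and u: "continuous_on {a..b} u"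
  obtains \<theta> where "solves_steering l a b u \<theta>" "\<theta> a = init"
proof -
  obtain C where C: "\<And>t. t \<in> {a..b} \<Longrightarrow> norm (u t) \<le> C"
    using continuous_on_compact_bound[OF compact_Icc u] by metis
  have "continuous_on ({a..b} \<times> UNIV) (\<lambda>(t, x). steer l (u t) x)"
  proof -
    have "continuous_on ({a..b} \<times> (UNIV :: real set)) (\<lambda>p. u (fst p))"
      by (rule continuous_on_compose2[OF u]) (auto intro!: continuous_intros)
    then show ?thesis
      using \<open>l > 0\<close> unfolding steer_def case_prod_unfold by (intro continuous_intros) auto
  qed
  moreover have "norm (steer l (u t) x - steer l (u t) y) \<le> 2 * C / l * norm (x - y)"
    if "t \<in> {a..b}" for t x y
  proof -
    have "2 * norm (u t) / l * \<bar>x - y\<bar> \<le> 2 * C / l * \<bar>x - y\<bar>"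
      using C[OF that] \<open>l > 0\<close> by (intro mult_right_mono divide_right_mono) auto
    then show ?thesis
      using abs_steer_diff_le[OF \<open>l > 0\<close>, of "u t" x y] by simp
  qed
  ultimately obtain \<theta> where "\<theta> a = init"
      "\<And>t. t \<in> {a..b} \<Longrightarrow> (\<theta> has_vector_derivative steer l (u t) (\<theta> t)) (at t within {a..b})"
    using lipschitz_ode_solution[OF \<open>a \<le> b\<close>, of "\<lambda>t x. steer l (u t) x"] by metis
  then show thesis
    by (intro that[of \<theta>]) (auto simp: solves_steering_def has_real_derivative_iff_has_vector_derivative)
qed

text \<open>By Gronwall's inequality the solution depends on the control in a Lipschitz way; the constant is
uniform in \<open>\<epsilon>\<close>, which is what the second order estimate below needs. The case \<open>\<epsilon> = 0\<close> is uniqueness.\<close>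

lemma steering_perturbation:
  assumes "l > 0" "a \<le> b" and u: "continuous_on {a..b} u" and h: "continuous_on {a..b} h"
    and sol: "solves_steering l a b u \<theta>"
  obtains C where "C \<ge> 0"
    "\<And>\<epsilon> \<eta> t. solves_steering l a b (\<lambda>t. u t + \<epsilon> *\<^sub>R h t) \<eta> \<Longrightarrow> \<eta> a = \<theta> a \<Longrightarrow> t \<in> {a..b} \<Longrightarrow>
      \<bar>\<eta> t - \<theta> t\<bar> \<le> C * \<bar>\<epsilon>\<bar>"
proof -
  obtain U where "U \<ge> 0" and U: "\<And>t. t \<in> {a..b} \<Longrightarrow> norm (u t) \<le> U"
    using continuous_on_compact_bound[OF compact_Icc u] by metis
  obtain H where "H \<ge> 0" and H: "\<And>t. t \<in> {a..b} \<Longrightarrow> norm (h t) \<le> H"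
    using continuous_on_compact_bound[OF compact_Icc h] by metis
  have "\<bar>\<eta> t - \<theta> t\<bar> \<le> (2 * H / l * exp ((2 * U / l + 1) * (b - a))) * \<bar>\<epsilon>\<bar>"
    if \<eta>: "solves_steering l a b (\<lambda>t. u t + \<epsilon> *\<^sub>R h t) \<eta>" "\<eta> a = \<theta> a" and t: "t \<in> {a..b}" for \<epsilon> \<eta> t
  proof -
    have "\<bar>\<eta> t - \<theta> t\<bar> \<le> (\<bar>\<epsilon>\<bar> * (2 * H / l)) * exp ((2 * U / l + 1) * (b - a))"
    proof (rule gronwall_from_zero[where w = "\<lambda>t. \<eta> t - \<theta> t"])
      show "((\<lambda>t. \<eta> t - \<theta> t) has_real_derivative
          steer l (u s + \<epsilon> *\<^sub>R h s) (\<eta> s) - steer l (u s) (\<theta> s)) (at s within {a..b})"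
        if "s \<in> {a..b}" for s
        using sol \<eta>(1) that by (auto simp: solves_steering_def intro!: derivative_intros)
      fix s assume s: "s \<in> {a..b}"
      have "\<bar>steer l (u s + \<epsilon> *\<^sub>R h s) (\<eta> s) - steer l (u s) (\<theta> s)\<bar>
          \<le> \<bar>steer l (u s) (\<eta> s) - steer l (u s) (\<theta> s)\<bar> + \<bar>\<epsilon>\<bar> * \<bar>steer l (h s) (\<eta> s)\<bar>"
        by (simp add: steer_add_control flip: abs_mult)
      also have "\<dots> \<le> 2 * norm (u s) / l * \<bar>\<eta> s - \<theta> s\<bar> + \<bar>\<epsilon>\<bar> * (2 * norm (h s) / l)"
        using \<open>l > 0\<close> by (intro add_mono mult_left_mono abs_steer_diff_le abs_steer_le) auto
      also have "\<dots> \<le> 2 * U / l * \<bar>\<eta> s - \<theta> s\<bar> + \<bar>\<epsilon>\<bar> * (2 * H / l)"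
        using \<open>l > 0\<close> U[OF s] H[OF s]
        by (intro add_mono mult_left_mono mult_right_mono divide_right_mono) auto
      finally show "\<bar>steer l (u s + \<epsilon> *\<^sub>R h s) (\<eta> s) - steer l (u s) (\<theta> s)\<bar>
          \<le> 2 * U / l * \<bar>\<eta> s - \<theta> s\<bar> + \<bar>\<epsilon>\<bar> * (2 * H / l)" .
    qed (use assms \<eta> t \<open>U \<ge> 0\<close> \<open>H \<ge> 0\<close> in auto)
    then show ?thesis by (simp add: algebra_simps)
  qed
  then show thesis
    using \<open>l > 0\<close> \<open>H \<ge> 0\<close> by (intro that[of "2 * H / l * exp ((2 * U / l + 1) * (b - a))"]) auto
qed

corollary steering_unique:
  assumes "l > 0" "a \<le> b" "continuous_on {a..b} u"
    and "solves_steering l a b u \<theta>" "solves_steering l a b u \<eta>" "\<eta> a = \<theta> a" "t \<in> {a..b}"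
  shows "\<eta> t = \<theta> t"
proof -
  obtain C where "\<And>\<epsilon> \<eta> t. solves_steering l a b (\<lambda>t. u t + \<epsilon> *\<^sub>R u t) \<eta> \<Longrightarrow> \<eta> a = \<theta> a \<Longrightarrow>
      t \<in> {a..b} \<Longrightarrow> \<bar>\<eta> t - \<theta> t\<bar> \<le> C * \<bar>\<epsilon>\<bar>"
    using steering_perturbation[OF assms(1,2,3,3,4)] by metis
  from this[of 0 \<eta> t] show ?thesis using assms by simp
qed

text \<open>The difference \<open>w\<close> of the perturbed and the unperturbed angle satisfies
\<open>w' = - drag * w + \<epsilon> * steer h + O(\<epsilon>\<^sup>2)\<close>. The integrating factor \<open>P\<close> removes the linear term, so
\<open>P * w\<close> at the end of the interval is \<open>\<epsilon>\<close> times the integral below up to an error of order \<open>\<epsilon>\<^sup>2\<close>.\<close>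

lemma steering_variation:
  assumes "l > 0" "a \<le> b" and u: "continuous_on {a..b} u" and h: "continuous_on {a..b} h"
    and sol: "solves_steering l a b u \<theta>"
    and pert: "\<And>\<epsilon>. solves_steering l a b (\<lambda>t. u t + \<epsilon> *\<^sub>R h t) (\<Theta> \<epsilon>)" "\<And>\<epsilon>. \<Theta> \<epsilon> a = \<theta> a"
    and P: "\<And>t. t \<in> {a..b} \<Longrightarrow>
      (P has_real_derivative P t * drag l (u t) (\<theta> t)) (at t within {a..b})"
    and "P b \<noteq> 0"
  shows "((\<lambda>\<epsilon>. \<Theta> \<epsilon> b) has_real_derivative
      integral {a..b} (\<lambda>t. P t * steer l (h t) (\<theta> t)) / P b) (at 0)"
proof -
  define J where "J = integral {a..b} (\<lambda>t. P t * steer l (h t) (\<theta> t))"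
  obtain C where "C \<ge> 0" and C: "\<And>\<epsilon> t. t \<in> {a..b} \<Longrightarrow> \<bar>\<Theta> \<epsilon> t - \<theta> t\<bar> \<le> C * \<bar>\<epsilon>\<bar>"
    using steering_perturbation[OF \<open>l > 0\<close> \<open>a \<le> b\<close> u h sol] pert by metis
  have P_cont: "continuous_on {a..b} P"
    using P by (meson DERIV_continuous continuous_on_eq_continuous_within)
  have \<theta>_cont: "continuous_on {a..b} \<theta>"
    using sol unfolding solves_steering_def
    by (meson DERIV_continuous continuous_on_eq_continuous_within)
  have integrand_cont: "continuous_on {a..b} (\<lambda>t. P t * steer l (h t) (\<theta> t))"
    using \<open>l > 0\<close> unfolding steer_def by (intro continuous_intros P_cont \<theta>_cont h) auto
  obtain U where "U \<ge> 0" and U: "\<And>t. t \<in> {a..b} \<Longrightarrow> norm (u t) \<le> U"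
    using continuous_on_compact_bound[OF compact_Icc u] by metis
  obtain H where "H \<ge> 0" and H: "\<And>t. t \<in> {a..b} \<Longrightarrow> norm (h t) \<le> H"
    using continuous_on_compact_bound[OF compact_Icc h] by metis
  obtain B where "B \<ge> 0" and B: "\<And>t. t \<in> {a..b} \<Longrightarrow> norm (P t) \<le> B"
    using continuous_on_compact_bound[OF compact_Icc P_cont] by metis
  define R where "R = B * (2 * U / l * C\<^sup>2 + 2 * H / l * C)"
  have "R \<ge> 0"
    using \<open>U \<ge> 0\<close> \<open>H \<ge> 0\<close> \<open>B \<ge> 0\<close> \<open>C \<ge> 0\<close> \<open>l > 0\<close> by (simp add: R_def)
  have estimate: "\<bar>P b * (\<Theta> \<epsilon> b - \<theta> b) - \<epsilon> * J\<bar> \<le> R * (b - a) * \<epsilon>\<^sup>2" for \<epsilon>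
  proof -
    define w where "w = (\<lambda>t. \<Theta> \<epsilon> t - \<theta> t)"
    have w_le: "\<bar>w t\<bar> \<le> C * \<bar>\<epsilon>\<bar>" if "t \<in> {a..b}" for t
      using C[OF that] by (simp add: w_def)
    \<comment> \<open>The error of the linearisation.\<close>
    define \<rho> where "\<rho> = (\<lambda>t. P t * (steer l (u t) (\<theta> t + w t) - steer l (u t) (\<theta> t)
        + w t * drag l (u t) (\<theta> t) + \<epsilon> * (steer l (h t) (\<theta> t + w t) - steer l (h t) (\<theta> t))))"
    have der: "((\<lambda>t. P t * w t) has_real_derivative \<rho> t + \<epsilon> * (P t * steer l (h t) (\<theta> t)))
        (at t within {a..b})" if t: "t \<in> {a..b}" for t
    proof -
      have "(w has_real_derivative
          steer l (u t + \<epsilon> *\<^sub>R h t) (\<Theta> \<epsilon> t) - steer l (u t) (\<theta> t)) (at t within {a..b})"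
        unfolding w_def using sol pert(1)[of \<epsilon>] t
        by (auto simp: solves_steering_def intro!: derivative_intros)
      moreover have "\<Theta> \<epsilon> t = \<theta> t + w t" by (simp add: w_def)
      ultimately show ?thesis
        by (auto intro!: derivative_eq_intros P[OF t]
            simp: \<rho>_def steer_add_control algebra_simps)
    qed
    have "((\<lambda>t. \<rho> t + \<epsilon> * (P t * steer l (h t) (\<theta> t))) has_integral
        P b * w b - P a * w a) {a..b}"
      using \<open>a \<le> b\<close> der
      by (intro fundamental_theorem_of_calculus)
        (auto simp flip: has_real_derivative_iff_has_vector_derivative)
    moreover have "((\<lambda>t. \<epsilon> * (P t * steer l (h t) (\<theta> t))) has_integral \<epsilon> * J) {a..b}"
      unfolding J_def
      by (intro has_integral_mult_right integrable_integral integrable_continuous_real integrand_cont)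
    ultimately have "((\<lambda>t. (\<rho> t + \<epsilon> * (P t * steer l (h t) (\<theta> t)))
          - \<epsilon> * (P t * steer l (h t) (\<theta> t))) has_integral
        (P b * w b - P a * w a) - \<epsilon> * J) {a..b}"
      by (rule has_integral_diff)
    then have \<rho>_int: "(\<rho> has_integral P b * (\<Theta> \<epsilon> b - \<theta> b) - \<epsilon> * J) (cbox a b)"
      using pert(2)[of \<epsilon>] by (simp add: w_def)
    have "norm (\<rho> t) \<le> R * \<epsilon>\<^sup>2" if t: "t \<in> {a..b}" for t
    proof -
      have "\<bar>steer l (u t) (\<theta> t + w t) - steer l (u t) (\<theta> t) + w t * drag l (u t) (\<theta> t)\<bar>
          \<le> 2 * norm (u t) / l * (w t)\<^sup>2"
        using abs_steer_taylor_le[OF \<open>l > 0\<close>] .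
      also have "\<dots> \<le> 2 * U / l * (C * \<bar>\<epsilon>\<bar>)\<^sup>2"
        using U[OF t] w_le[OF t] \<open>l > 0\<close> \<open>U \<ge> 0\<close> \<open>C \<ge> 0\<close>
        by (intro mult_mono divide_right_mono) (auto simp flip: abs_le_square_iff)
      finally have 1: "\<bar>steer l (u t) (\<theta> t + w t) - steer l (u t) (\<theta> t) + w t * drag l (u t) (\<theta> t)\<bar>
          \<le> 2 * U / l * C\<^sup>2 * \<epsilon>\<^sup>2"
        by (simp add: power_mult_distrib)
      have "\<bar>steer l (h t) (\<theta> t + w t) - steer l (h t) (\<theta> t)\<bar> \<le> 2 * norm (h t) / l * \<bar>w t\<bar>"
        using abs_steer_diff_le[OF \<open>l > 0\<close>, of "h t" "\<theta> t + w t" "\<theta> t"] by simp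
      also have "\<dots> \<le> 2 * H / l * (C * \<bar>\<epsilon>\<bar>)"
        using H[OF t] w_le[OF t] \<open>l > 0\<close> \<open>H \<ge> 0\<close>
        by (intro mult_mono divide_right_mono) auto
      finally have *: "\<bar>\<epsilon>\<bar> * \<bar>steer l (h t) (\<theta> t + w t) - steer l (h t) (\<theta> t)\<bar>
          \<le> \<bar>\<epsilon>\<bar> * (2 * H / l * (C * \<bar>\<epsilon>\<bar>))"
        by (intro mult_left_mono) auto
      have 2: "\<bar>\<epsilon> * (steer l (h t) (\<theta> t + w t) - steer l (h t) (\<theta> t))\<bar> \<le> 2 * H / l * C * \<epsilon>\<^sup>2"
      proof -
        have "\<bar>\<epsilon>\<bar> * (2 * H / l * (C * \<bar>\<epsilon>\<bar>)) = 2 * H / l * C * (\<bar>\<epsilon>\<bar> * \<bar>\<epsilon>\<bar>)"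
          by (simp only: ac_simps)
        with * show ?thesis by (simp only: abs_mult abs_mult_self_eq power2_eq_square)
      qed
      have "\<bar>steer l (u t) (\<theta> t + w t) - steer l (u t) (\<theta> t) + w t * drag l (u t) (\<theta> t)
          + \<epsilon> * (steer l (h t) (\<theta> t + w t) - steer l (h t) (\<theta> t))\<bar>
          \<le> 2 * U / l * C\<^sup>2 * \<epsilon>\<^sup>2 + 2 * H / l * C * \<epsilon>\<^sup>2"
        using 1 2 by (rule order_trans[OF abs_triangle_ineq add_mono])
      then have "\<bar>\<rho> t\<bar> \<le> B * (2 * U / l * C\<^sup>2 * \<epsilon>\<^sup>2 + 2 * H / l * C * \<epsilon>\<^sup>2)"
        unfolding \<rho>_def abs_mult using B[OF t] \<open>B \<ge> 0\<close>
        by (intro mult_mono) auto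
      then show ?thesis by (simp add: R_def algebra_simps)
    qed
    then show ?thesis
      using has_integral_bound[OF _ \<rho>_int, of "R * \<epsilon>\<^sup>2"] \<open>R \<ge> 0\<close> \<open>a \<le> b\<close>
      by (simp add: algebra_simps)
  qed
  have \<Theta>0: "\<Theta> 0 b = \<theta> b"
    using estimate[of 0] \<open>P b \<noteq> 0\<close> by simp
  have "((\<lambda>\<epsilon>. P b * (\<Theta> \<epsilon> b - \<theta> b)) has_derivative (\<lambda>\<epsilon>. \<epsilon> * J)) (at 0)"
  proof (rule has_derivativeI_sandwich[where e = 1 and H = "\<lambda>\<epsilon>. R * (b - a) * \<bar>\<epsilon>\<bar>"])
    show "bounded_linear (\<lambda>\<epsilon>. \<epsilon> * J)" by (rule bounded_linear_mult_left)
    show "((\<lambda>\<epsilon>. R * (b - a) * \<bar>\<epsilon>\<bar>) \<longlongrightarrow> 0) (at 0)"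
      by (auto intro!: tendsto_eq_intros)
    show "norm (P b * (\<Theta> \<epsilon> b - \<theta> b) - P b * (\<Theta> 0 b - \<theta> b) - (\<epsilon> - 0) * J) / norm (\<epsilon> - 0)
        \<le> R * (b - a) * \<bar>\<epsilon>\<bar>" if "\<epsilon> \<noteq> 0" "dist \<epsilon> 0 < 1" for \<epsilon> :: real
      using estimate[of \<epsilon>] that
      by (simp add: \<Theta>0 divide_le_eq power2_eq_square mult.assoc)
  qed auto
  then have "((\<lambda>\<epsilon>. P b * (\<Theta> \<epsilon> b - \<theta> b)) has_real_derivative J) (at 0)"
    by (simp add: has_field_derivative_def mult.commute[of _ J])
  from DERIV_cdivide[OF this, of "P b"]
  have "((\<lambda>\<epsilon>. \<Theta> \<epsilon> b - \<theta> b) has_real_derivative J / P b) (at 0)"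
    using \<open>P b \<noteq> 0\<close> by simp
  from DERIV_add[OF this DERIV_const[of "\<theta> b"]] show ?thesis
    by (simp add: J_def)
qed

section \<open>The endpoint map and its derivative\<close>

lemma coords_curve_cases:
  fixes q :: "real \<Rightarrow> coords"
  obtains x y \<theta>1 \<theta>2 where "q = (\<lambda>t. (x t, y t, \<theta>1 t, \<theta>2 t))"
proof
  show "q = (\<lambda>t. (fst (q t), fst (snd (q t)), fst (snd (snd (q t))), snd (snd (snd (q t)))))"
    by simp
qed

lemma has_vector_derivative_fst_snd:
  assumes "(f has_vector_derivative f') (at t within S)"
  shows "((\<lambda>t. fst (f t)) has_vector_derivative fst f') (at t within S)"
    and "((\<lambda>t. snd (f t)) has_vector_derivative snd f') (at t within S)"
  using assms bounded_linear.has_vector_derivative bounded_linear_fst bounded_linear_snd by blast+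

lemma has_vector_derivative_coords_iff:
  fixes x y \<theta>1 \<theta>2 :: "real \<Rightarrow> real"
  shows "((\<lambda>t. (x t, y t, \<theta>1 t, \<theta>2 t)) has_vector_derivative (x', y', \<theta>1', \<theta>2')) (at t within S) \<longleftrightarrow>
    (x has_real_derivative x') (at t within S) \<and> (y has_real_derivative y') (at t within S) \<and>
    (\<theta>1 has_real_derivative \<theta>1') (at t within S) \<and> (\<theta>2 has_real_derivative \<theta>2') (at t within S)"
  unfolding has_real_derivative_iff_has_vector_derivative
proof safe
  assume *: "((\<lambda>t. (x t, y t, \<theta>1 t, \<theta>2 t)) has_vector_derivative (x', y', \<theta>1', \<theta>2')) (at t within S)"
  show "(x has_vector_derivative x') (at t within S)"
    using has_vector_derivative_fst_snd(1)[OF *] by simp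
  show "(y has_vector_derivative y') (at t within S)"
    using has_vector_derivative_fst_snd(1)[OF has_vector_derivative_fst_snd(2)[OF *]] by simp
  show "(\<theta>1 has_vector_derivative \<theta>1') (at t within S)"
    using has_vector_derivative_fst_snd(1)[OF has_vector_derivative_fst_snd(2)
        [OF has_vector_derivative_fst_snd(2)[OF *]]] by simp
  show "(\<theta>2 has_vector_derivative \<theta>2') (at t within S)"
    using has_vector_derivative_fst_snd(2)[OF has_vector_derivative_fst_snd(2)
        [OF has_vector_derivative_fst_snd(2)[OF *]]] by simp
qed (intro has_vector_derivative_Pair)

lemma frame_combination:
  "u1 *\<^sub>R v1 l1 l2 (x, y, \<theta>1, \<theta>2) + u2 *\<^sub>R v2 l1 l2 (x, y, \<theta>1, \<theta>2)
    = (u1, u2, steer l1 (u1, u2) \<theta>1, steer l2 (u1, u2) \<theta>2)"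
  by (simp add: v1_def v2_def steer_def add_divide_distrib diff_divide_distrib algebra_simps)

lemma trajectory_iff:
  "trajectory l1 l2 a b u (\<lambda>t. (x t, y t, \<theta>1 t, \<theta>2 t)) \<longleftrightarrow>
    (\<forall>t\<in>{a..b}. (x has_real_derivative fst (u t)) (at t within {a..b})) \<and>
    (\<forall>t\<in>{a..b}. (y has_real_derivative snd (u t)) (at t within {a..b})) \<and>
    solves_steering l1 a b u \<theta>1 \<and> solves_steering l2 a b u \<theta>2"
  unfolding trajectory_def solves_steering_def frame_combination has_vector_derivative_coords_iff
  by auto

text \<open>The position is the integral of the control and the two angles evolve independently of it and of each
other, so existence and uniqueness reduce to the equation of a single angle.\<close>

lemma endpoint_map_eq:
  fixes u :: "real \<Rightarrow>\<^sub>C (real \<times> real)"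
  assumes "l1 > 0" "l2 > 0" "a \<le> b"
    and "solves_steering l1 a b u \<theta>1" "solves_steering l2 a b u \<theta>2"
  shows "endpoint_map l1 l2 a b (x0, y0, \<theta>1 a, \<theta>2 a) u
    = (x0 + integral {a..b} (\<lambda>t. fst (u t)), y0 + integral {a..b} (\<lambda>t. snd (u t)), \<theta>1 b, \<theta>2 b)"
  unfolding endpoint_map_def
proof (rule the_equality)
  let ?x = "\<lambda>t. x0 + integral {a..t} (\<lambda>t. fst (u t))"
  let ?y = "\<lambda>t. y0 + integral {a..t} (\<lambda>t. snd (u t))"
  have "trajectory l1 l2 a b u (\<lambda>t. (?x t, ?y t, \<theta>1 t, \<theta>2 t))"
    unfolding trajectory_iff using assms
    by (auto intro!: derivative_eq_intros integral_has_real_derivative continuous_intros)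
  then show "\<exists>q. trajectory l1 l2 a b u q \<and> q a = (x0, y0, \<theta>1 a, \<theta>2 a) \<and>
      q b = (?x b, ?y b, \<theta>1 b, \<theta>2 b)"
    by (intro exI[of _ "\<lambda>t. (?x t, ?y t, \<theta>1 t, \<theta>2 t)"]) auto
next
  fix p
  assume "\<exists>q. trajectory l1 l2 a b u q \<and> q a = (x0, y0, \<theta>1 a, \<theta>2 a) \<and> q b = p"
  then obtain q where "trajectory l1 l2 a b u q" "q a = (x0, y0, \<theta>1 a, \<theta>2 a)" "q b = p"
    by blast
  moreover obtain x y \<eta>1 \<eta>2 where "q = (\<lambda>t. (x t, y t, \<eta>1 t, \<eta>2 t))"
    by (rule coords_curve_cases)
  ultimately have traj: "trajectory l1 l2 a b u (\<lambda>t. (x t, y t, \<eta>1 t, \<eta>2 t))"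
    and init: "x a = x0" "y a = y0" "\<eta>1 a = \<theta>1 a" "\<eta>2 a = \<theta>2 a"
    and p: "p = (x b, y b, \<eta>1 b, \<eta>2 b)"
    by auto
  have "((\<lambda>t. fst (u t)) has_integral x b - x a) {a..b}"
    "((\<lambda>t. snd (u t)) has_integral y b - y a) {a..b}"
    using traj \<open>a \<le> b\<close> unfolding trajectory_iff
    by (auto intro!: fundamental_theorem_of_calculus
        simp flip: has_real_derivative_iff_has_vector_derivative)
  moreover have "\<eta>1 b = \<theta>1 b"
    using traj init assms unfolding trajectory_iff
    by (intro steering_unique[of l1 a b u \<theta>1 \<eta>1 b]) auto
  moreover have "\<eta>2 b = \<theta>2 b"
    using traj init assms unfolding trajectory_iff
    by (intro steering_unique[of l2 a b u \<theta>2 \<eta>2 b]) auto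
  ultimately show "p = (x0 + integral {a..b} (\<lambda>t. fst (u t)),
      y0 + integral {a..b} (\<lambda>t. snd (u t)), \<theta>1 b, \<theta>2 b)"
    by (simp add: p init integral_unique)
qed

text \<open>Since the endpoint map is assumed to be Frechet differentiable, its derivative is determined by the
directional derivatives, and these come from the variation of each angle.\<close>

lemma endpoint_derivative:
  assumes "l1 > 0" "l2 > 0" "a \<le> b"
    and traj: "trajectory l1 l2 a b u (\<lambda>t. (x t, y t, \<theta>1 t, \<theta>2 t))"
    and D: "(endpoint_map l1 l2 a b (x a, y a, \<theta>1 a, \<theta>2 a) has_derivative D) (at u)"
    and P1: "\<And>t. t \<in> {a..b} \<Longrightarrow>
      (P1 has_real_derivative P1 t * drag l1 (u t) (\<theta>1 t)) (at t within {a..b})" "P1 b \<noteq> 0"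
    and P2: "\<And>t. t \<in> {a..b} \<Longrightarrow>
      (P2 has_real_derivative P2 t * drag l2 (u t) (\<theta>2 t)) (at t within {a..b})" "P2 b \<noteq> 0"
  shows "D h = (integral {a..b} (\<lambda>t. fst (h t)), integral {a..b} (\<lambda>t. snd (h t)),
    integral {a..b} (\<lambda>t. P1 t * steer l1 (h t) (\<theta>1 t)) / P1 b,
    integral {a..b} (\<lambda>t. P2 t * steer l2 (h t) (\<theta>2 t)) / P2 b)"
proof -
  have sol: "solves_steering l1 a b u \<theta>1" "solves_steering l2 a b u \<theta>2"
    using traj by (auto simp: trajectory_iff)
  have perturb: "apply_bcontfun (u + \<epsilon> *\<^sub>R h) = (\<lambda>t. u t + \<epsilon> *\<^sub>R h t)" for \<epsilon>
    by (simp add: plus_bcontfun.rep_eq scaleR_bcontfun.rep_eq)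
  have "\<exists>\<Theta>. \<forall>\<epsilon>. solves_steering l a b (\<lambda>t. u t + \<epsilon> *\<^sub>R h t) (\<Theta> \<epsilon>) \<and> \<Theta> \<epsilon> a = init"
    if "l > 0" for l init
  proof (intro choice allI)
    fix \<epsilon>
    have "continuous_on {a..b} (\<lambda>t. u t + \<epsilon> *\<^sub>R h t)"
      by (intro continuous_intros) auto
    from steering_solution[OF that \<open>a \<le> b\<close> this, of init]
    show "\<exists>\<eta>. solves_steering l a b (\<lambda>t. u t + \<epsilon> *\<^sub>R h t) \<eta> \<and> \<eta> a = init" by blast
  qed
  note perturbed_solutions = this
  obtain \<Theta>1 where \<Theta>1: "\<And>\<epsilon>. solves_steering l1 a b (\<lambda>t. u t + \<epsilon> *\<^sub>R h t) (\<Theta>1 \<epsilon>)"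
      "\<And>\<epsilon>. \<Theta>1 \<epsilon> a = \<theta>1 a"
    using perturbed_solutions[OF \<open>l1 > 0\<close>, of "\<theta>1 a"] by blast
  obtain \<Theta>2 where \<Theta>2: "\<And>\<epsilon>. solves_steering l2 a b (\<lambda>t. u t + \<epsilon> *\<^sub>R h t) (\<Theta>2 \<epsilon>)"
      "\<And>\<epsilon>. \<Theta>2 \<epsilon> a = \<theta>2 a"
    using perturbed_solutions[OF \<open>l2 > 0\<close>, of "\<theta>2 a"] by blast
  let ?E = "endpoint_map l1 l2 a b (x a, y a, \<theta>1 a, \<theta>2 a)"
  have integrable: "(\<lambda>t. fst (g t)) integrable_on {a..b}" "(\<lambda>t. snd (g t)) integrable_on {a..b}"
    for g :: "real \<Rightarrow>\<^sub>C (real \<times> real)"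
    by (auto intro!: integrable_continuous_real continuous_intros)
  have split: "integral {a..b} (\<lambda>t. fst (u t) + \<epsilon> * fst (h t))
      = integral {a..b} (\<lambda>t. fst (u t)) + \<epsilon> * integral {a..b} (\<lambda>t. fst (h t))"
    "integral {a..b} (\<lambda>t. snd (u t) + \<epsilon> * snd (h t))
      = integral {a..b} (\<lambda>t. snd (u t)) + \<epsilon> * integral {a..b} (\<lambda>t. snd (h t))" for \<epsilon>
    using integrable[of u] integrable[of h]
    by (subst integral_add; simp add: integrable_on_mult_right)+
  have E: "?E (u + \<epsilon> *\<^sub>R h) =
      (x a + integral {a..b} (\<lambda>t. fst (u t)) + \<epsilon> * integral {a..b} (\<lambda>t. fst (h t)),
       y a + integral {a..b} (\<lambda>t. snd (u t)) + \<epsilon> * integral {a..b} (\<lambda>t. snd (h t)), \<Theta>1 \<epsilon> b, \<Theta>2 \<epsilon> b)"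
    for \<epsilon>
  proof -
    have "solves_steering l1 a b (u + \<epsilon> *\<^sub>R h) (\<Theta>1 \<epsilon>)" "solves_steering l2 a b (u + \<epsilon> *\<^sub>R h) (\<Theta>2 \<epsilon>)"
      unfolding perturb by (rule \<Theta>1 \<Theta>2)+
    from endpoint_map_eq[OF assms(1-3) this, of "x a" "y a"] show ?thesis
      by (simp add: perturb split \<Theta>1(2) \<Theta>2(2))
  qed
  have "((\<lambda>\<epsilon>. ?E (u + \<epsilon> *\<^sub>R h)) has_vector_derivative
      (integral {a..b} (\<lambda>t. fst (h t)), integral {a..b} (\<lambda>t. snd (h t)),
       integral {a..b} (\<lambda>t. P1 t * steer l1 (h t) (\<theta>1 t)) / P1 b,
       integral {a..b} (\<lambda>t. P2 t * steer l2 (h t) (\<theta>2 t)) / P2 b)) (at 0)"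
    unfolding E has_vector_derivative_coords_iff
  proof (intro conjI)
    show "((\<lambda>\<epsilon>. \<Theta>1 \<epsilon> b) has_real_derivative
        integral {a..b} (\<lambda>t. P1 t * steer l1 (h t) (\<theta>1 t)) / P1 b) (at 0)"
      using steering_variation[OF \<open>l1 > 0\<close> \<open>a \<le> b\<close> _ _ sol(1) \<Theta>1 P1] by simp
    show "((\<lambda>\<epsilon>. \<Theta>2 \<epsilon> b) has_real_derivative
        integral {a..b} (\<lambda>t. P2 t * steer l2 (h t) (\<theta>2 t)) / P2 b) (at 0)"
      using steering_variation[OF \<open>l2 > 0\<close> \<open>a \<le> b\<close> _ _ sol(2) \<Theta>2 P2] by simp
  qed (auto intro!: derivative_eq_intros)
  moreover have "((\<lambda>\<epsilon>. ?E (u + \<epsilon> *\<^sub>R h)) has_vector_derivative D h) (at 0)"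
  proof -
    have "((\<lambda>\<epsilon>. u + \<epsilon> *\<^sub>R h) has_derivative (\<lambda>\<epsilon>. \<epsilon> *\<^sub>R h)) (at 0)"
      by (auto intro!: derivative_eq_intros)
    moreover have "(?E has_derivative D) (at (u + 0 *\<^sub>R h))"
      using D by simp
    ultimately have "((\<lambda>\<epsilon>. ?E (u + \<epsilon> *\<^sub>R h)) has_derivative (\<lambda>\<epsilon>. D (\<epsilon> *\<^sub>R h))) (at 0)"
      by (rule has_derivative_compose)
    then show ?thesis
      using linear_cmul[OF has_derivative_linear[OF D]] by (simp add: has_vector_derivative_def)
  qed
  ultimately show ?thesis
    by (rule vector_derivative_unique_at[rotated])
qed

section \<open>Multipliers along a critical arc\<close>

lemma integrating_factor:
  fixes m :: "real \<Rightarrow> real"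
  assumes "continuous_on {a..b} m"
  obtains P where "\<And>t. P t > 0"
    "\<And>t. t \<in> {a..b} \<Longrightarrow> (P has_real_derivative P t * m t) (at t within {a..b})"
proof
  show "((\<lambda>t. exp (integral {a..t} m)) has_real_derivative exp (integral {a..t} m) * m t)
      (at t within {a..b})" if "t \<in> {a..b}" for t
    using assms that by (auto intro!: derivative_eq_intros integral_has_real_derivative)
qed simp

text \<open>The multiplier rule for a critical arc. A covector that annihilates the range of the derivative
of the endpoint map, transported backwards by the integrating factors, annihilates both fields of the
frame at every time: the pairing with the derivative in direction \<open>h\<close> is the integral of a
continuous function \<open>f\<close> against \<open>h\<close>, and for \<open>h = f\<close> this is the integral of \<open>\<bar>f\<bar>\<^sup>2\<close>. The first two
components \<open>p1\<close>, \<open>- p2\<close> of the transported covector are constant because the frame does not depend on the position.\<close>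

lemma critical_arc_multipliers:
  assumes "l1 > 0" "l2 > 0" "a < b"
    and crit: "critical_arc l1 l2 a b (\<lambda>t. (x t, y t, \<theta>1 t, \<theta>2 t))"
  obtains u \<mu>1 \<mu>2 p1 p2 where
    "trajectory l1 l2 a b u (\<lambda>t. (x t, y t, \<theta>1 t, \<theta>2 t))"
    "\<And>t. t \<in> {a..b} \<Longrightarrow>
      (\<mu>1 has_real_derivative \<mu>1 t * drag l1 (u t) (\<theta>1 t)) (at t within {a..b})"
    "\<And>t. t \<in> {a..b} \<Longrightarrow>
      (\<mu>2 has_real_derivative \<mu>2 t * drag l2 (u t) (\<theta>2 t)) (at t within {a..b})"
    "\<And>t. t \<in> {a..b} \<Longrightarrow> p1 = \<mu>1 t / l1 * sin (\<theta>1 t) + \<mu>2 t / l2 * sin (\<theta>2 t)"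
    "\<And>t. t \<in> {a..b} \<Longrightarrow> p2 = \<mu>1 t / l1 * cos (\<theta>1 t) + \<mu>2 t / l2 * cos (\<theta>2 t)"
    "\<And>t. t \<in> {a..b} \<Longrightarrow> \<mu>1 t \<noteq> 0 \<or> \<mu>2 t \<noteq> 0"
proof -
  obtain u D where traj: "trajectory l1 l2 a b u (\<lambda>t. (x t, y t, \<theta>1 t, \<theta>2 t))"
    and D: "(endpoint_map l1 l2 a b (x a, y a, \<theta>1 a, \<theta>2 a) has_derivative D) (at u)"
    and "\<not> surj D"
    using crit unfolding critical_arc_def by blast
  have \<theta>_cont [continuous_intros]: "continuous_on {a..b} \<theta>1" "continuous_on {a..b} \<theta>2"
    using traj unfolding trajectory_iff solves_steering_def
    by (meson DERIV_continuous continuous_on_eq_continuous_within)+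
  have drag_cont: "continuous_on {a..b} (\<lambda>t. drag l1 (u t) (\<theta>1 t))"
    "continuous_on {a..b} (\<lambda>t. drag l2 (u t) (\<theta>2 t))"
    unfolding drag_def using assms by (auto intro!: continuous_intros)
  obtain P1 where P1_pos: "\<And>t. P1 t > 0"
    and P1: "\<And>t. t \<in> {a..b} \<Longrightarrow>
      (P1 has_real_derivative P1 t * drag l1 (u t) (\<theta>1 t)) (at t within {a..b})"
    by (rule integrating_factor[OF drag_cont(1)]) blast
  obtain P2 where P2_pos: "\<And>t. P2 t > 0"
    and P2: "\<And>t. t \<in> {a..b} \<Longrightarrow>
      (P2 has_real_derivative P2 t * drag l2 (u t) (\<theta>2 t)) (at t within {a..b})"
    by (rule integrating_factor[OF drag_cont(2)]) blast
  have P_cont [continuous_intros]: "continuous_on {a..b} P1" "continuous_on {a..b} P2"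
    using P1 P2 by (meson DERIV_continuous continuous_on_eq_continuous_within)+
  have "span (range D) = range D"
    using has_derivative_linear[OF D] by (metis linear_subspace_image span_eq_iff subspace_UNIV)
  then have "span (range D) \<noteq> UNIV"
    using \<open>\<not> surj D\<close> by metis
  then obtain p where "p \<noteq> 0" "span (range D) \<subseteq> {x. p \<bullet> x = 0}"
    using span_not_univ_subset_hyperplane by blast
  then have "\<And>h. p \<bullet> D h = 0"
    using span_superset[of "range D"] by blast
  moreover note \<open>p \<noteq> 0\<close>
  moreover obtain q1 q2 m1 m2 where "p = (q1, q2, m1, m2)"
    by (cases p) auto
  ultimately have nonzero: "(q1, q2, m1, m2) \<noteq> (0 :: coords)"
    and orth: "\<And>h. (q1, q2, m1, m2) \<bullet> D h = 0"
    by auto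
  define c1 c2 where "c1 = m1 / P1 b" and "c2 = m2 / P2 b"
  define \<mu>1 \<mu>2 where "\<mu>1 = (\<lambda>t. c1 * P1 t)" and "\<mu>2 = (\<lambda>t. c2 * P2 t)"
  define f where "f = (\<lambda>t. (q1 - \<mu>1 t / l1 * sin (\<theta>1 t) - \<mu>2 t / l2 * sin (\<theta>2 t),
    q2 + \<mu>1 t / l1 * cos (\<theta>1 t) + \<mu>2 t / l2 * cos (\<theta>2 t)))"
  have f_cont [continuous_intros]: "continuous_on {a..b} f"
    unfolding f_def \<mu>1_def \<mu>2_def using assms by (auto intro!: continuous_intros)
  obtain h :: "real \<Rightarrow>\<^sub>C (real \<times> real)" where h: "\<And>t. t \<in> {a..b} \<Longrightarrow> h t = f t"
    using continuous_on_cbox_bcontfunE[of a b f] f_cont by (metis cbox_interval)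
  have "f t = 0" if "t \<in> {a..b}" for t
  proof -
    have ints: "(\<lambda>t. fst (h t)) integrable_on {a..b}" "(\<lambda>t. snd (h t)) integrable_on {a..b}"
      "(\<lambda>t. P1 t * steer l1 (h t) (\<theta>1 t)) integrable_on {a..b}"
      "(\<lambda>t. P2 t * steer l2 (h t) (\<theta>2 t)) integrable_on {a..b}"
      unfolding steer_def using assms
      by (auto intro!: integrable_continuous_real continuous_intros)
    have "integral {a..b} (\<lambda>t. (norm (f t))\<^sup>2)
        = integral {a..b} (\<lambda>t. q1 * fst (h t) + q2 * snd (h t)
          + c1 * (P1 t * steer l1 (h t) (\<theta>1 t)) + c2 * (P2 t * steer l2 (h t) (\<theta>2 t)))"
    proof (rule integral_cong)
      fix t assume "t \<in> {a..b}"
      then have "h t = f t" by (rule h)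
      have "q1 * X + q2 * Y + c1 * (P1 t * steer l1 (X, Y) (\<theta>1 t)) + c2 * (P2 t * steer l2 (X, Y) (\<theta>2 t))
          = (q1 - \<mu>1 t / l1 * sin (\<theta>1 t) - \<mu>2 t / l2 * sin (\<theta>2 t)) * X
            + (q2 + \<mu>1 t / l1 * cos (\<theta>1 t) + \<mu>2 t / l2 * cos (\<theta>2 t)) * Y" for X Y
        using assms by (simp add: steer_def \<mu>1_def \<mu>2_def field_simps)
      from this[of "fst (f t)" "snd (f t)"]
      show "(norm (f t))\<^sup>2 = q1 * fst (h t) + q2 * snd (h t)
          + c1 * (P1 t * steer l1 (h t) (\<theta>1 t)) + c2 * (P2 t * steer l2 (h t) (\<theta>2 t))"
        unfolding \<open>h t = f t\<close> by (simp add: f_def norm_Pair power2_eq_square)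
    qed
    also have "\<dots> = q1 * integral {a..b} (\<lambda>t. fst (h t)) + q2 * integral {a..b} (\<lambda>t. snd (h t))
        + c1 * integral {a..b} (\<lambda>t. P1 t * steer l1 (h t) (\<theta>1 t))
        + c2 * integral {a..b} (\<lambda>t. P2 t * steer l2 (h t) (\<theta>2 t))"
      by (simp add: integral_add integrable_add integrable_on_mult_right ints)
    also have "\<dots> = (q1, q2, m1, m2) \<bullet> D h"
      using endpoint_derivative[OF assms(1,2) _ traj D P1 _ P2, of h] P1_pos[of b] P2_pos[of b] \<open>a < b\<close>
      by (simp add: c1_def c2_def)
    finally have "integral {a..b} (\<lambda>t. (norm (f t))\<^sup>2) = 0"
      by (simp add: orth)
    then have "(norm (f t))\<^sup>2 = 0"
      using that \<open>a < b\<close>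
      by (subst (asm) integral_eq_0_iff) (auto intro!: continuous_intros)
    then show ?thesis by simp
  qed
  then have zero: "q1 = \<mu>1 t / l1 * sin (\<theta>1 t) + \<mu>2 t / l2 * sin (\<theta>2 t)"
    "- q2 = \<mu>1 t / l1 * cos (\<theta>1 t) + \<mu>2 t / l2 * cos (\<theta>2 t)" if "t \<in> {a..b}" for t
    using that unfolding f_def zero_prod_def prod.inject by fastforce+
  show thesis
  proof (rule that[OF traj _ _ zero])
    show "(\<mu>1 has_real_derivative \<mu>1 t * drag l1 (u t) (\<theta>1 t)) (at t within {a..b})"
      "(\<mu>2 has_real_derivative \<mu>2 t * drag l2 (u t) (\<theta>2 t)) (at t within {a..b})"
      if "t \<in> {a..b}" for t
      unfolding \<mu>1_def \<mu>2_def using P1[OF that] P2[OF that]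
      by (auto intro!: derivative_eq_intros simp: algebra_simps)
    show "\<mu>1 t \<noteq> 0 \<or> \<mu>2 t \<noteq> 0" if t: "t \<in> {a..b}" for t
    proof (rule ccontr)
      assume "\<not> (\<mu>1 t \<noteq> 0 \<or> \<mu>2 t \<noteq> 0)"
      then have "m1 = 0" "m2 = 0" "q1 = 0" "q2 = 0"
        using zero[OF t] P1_pos[of t] P2_pos[of t] P1_pos[of b] P2_pos[of b] by (auto simp: \<mu>1_def \<mu>2_def c1_def c2_def)
      then show False using nonzero by (simp add: zero_prod_def)
    qed
  qed auto
qed

text \<open>Recovering the velocity from its components along and across the segment.\<close>

lemma steer_drag_sin_cos:
  "drag l u \<theta> * sin \<theta> + steer l u \<theta> * cos \<theta> = snd u / l"
  "drag l u \<theta> * cos \<theta> - steer l u \<theta> * sin \<theta> = fst u / l"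
proof -
  have "(cos \<theta> * U + sin \<theta> * V) * sin \<theta> + (- sin \<theta> * U + cos \<theta> * V) * cos \<theta> = V"
    "(cos \<theta> * U + sin \<theta> * V) * cos \<theta> - (- sin \<theta> * U + cos \<theta> * V) * sin \<theta> = U" for U V
    using sin_cos_squared_add[of \<theta>] by algebra+
  then show "drag l u \<theta> * sin \<theta> + steer l u \<theta> * cos \<theta> = snd u / l"
    "drag l u \<theta> * cos \<theta> - steer l u \<theta> * sin \<theta> = fst u / l"
    unfolding drag_def steer_def
    by (simp_all only: times_divide_eq_left add_divide_distrib[symmetric] diff_divide_distrib[symmetric])
qed

text \<open>Along a critical arc the velocity is orthogonal to \<open>e1 / l1 - e2 / l2\<close>, where \<open>ei\<close> is the unit vector
of direction \<open>\<theta>i\<close>; this is the direction field that defines the singular curves. The multiplier rule says that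
\<open>(\<mu>1 / l1) e1 + (\<mu>2 / l2) e2\<close> is constant. Its two terms have the derivatives
\<open>(\<mu>1 / l1\<^sup>2) u\<close> and \<open>(\<mu>2 / l2\<^sup>2) u\<close> for the velocity \<open>u\<close>, whence
\<open>\<mu>1 / l1\<^sup>2 + \<mu>2 / l2\<^sup>2 = 0\<close>; this relation is differentiated once more.\<close>

lemma critical_arc_drag_eq:
  assumes "l1 > 0" "l2 > 0" "a < b"
    and crit: "critical_arc l1 l2 a b (\<lambda>t. (x t, y t, \<theta>1 t, \<theta>2 t))"
    and vel: "\<And>t. t \<in> {a..b} \<Longrightarrow> ((\<lambda>t. (x t, y t, \<theta>1 t, \<theta>2 t)) has_vector_derivative q' t)
      (at t within {a..b})"
    and regular: "\<And>t. t \<in> {a..b} \<Longrightarrow> q' t \<noteq> 0"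
    and t: "t \<in> {a..b}"
  shows "drag l1 (fst (q' t), fst (snd (q' t))) (\<theta>1 t) = drag l2 (fst (q' t), fst (snd (q' t))) (\<theta>2 t)"
proof -
  obtain u \<mu>1 \<mu>2 p1 p2 where traj: "trajectory l1 l2 a b u (\<lambda>t. (x t, y t, \<theta>1 t, \<theta>2 t))"
    and \<mu>: "\<And>t. t \<in> {a..b} \<Longrightarrow>
        (\<mu>1 has_real_derivative \<mu>1 t * drag l1 (u t) (\<theta>1 t)) (at t within {a..b})"
      "\<And>t. t \<in> {a..b} \<Longrightarrow>
        (\<mu>2 has_real_derivative \<mu>2 t * drag l2 (u t) (\<theta>2 t)) (at t within {a..b})"
    and p: "\<And>t. t \<in> {a..b} \<Longrightarrow> p1 = \<mu>1 t / l1 * sin (\<theta>1 t) + \<mu>2 t / l2 * sin (\<theta>2 t)"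
      "\<And>t. t \<in> {a..b} \<Longrightarrow> p2 = \<mu>1 t / l1 * cos (\<theta>1 t) + \<mu>2 t / l2 * cos (\<theta>2 t)"
    and nonzero: "\<And>t. t \<in> {a..b} \<Longrightarrow> \<mu>1 t \<noteq> 0 \<or> \<mu>2 t \<noteq> 0"
    by (rule critical_arc_multipliers[OF assms(1-4)]) blast
  have \<theta>: "(\<theta>1 has_real_derivative steer l1 (u t) (\<theta>1 t)) (at t within {a..b})"
    "(\<theta>2 has_real_derivative steer l2 (u t) (\<theta>2 t)) (at t within {a..b})" if "t \<in> {a..b}" for t
    using traj that by (auto simp: trajectory_iff solves_steering_def)
  have vel_eq: "q' t = (fst (u t), snd (u t), steer l1 (u t) (\<theta>1 t), steer l2 (u t) (\<theta>2 t))"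
    if t: "t \<in> {a..b}" for t
  proof (rule vector_derivative_unique_within_closed_interval[OF \<open>a < b\<close>, of t])
    show "((\<lambda>t. (x t, y t, \<theta>1 t, \<theta>2 t)) has_vector_derivative
        (fst (u t), snd (u t), steer l1 (u t) (\<theta>1 t), steer l2 (u t) (\<theta>2 t))) (at t within cbox a b)"
      using traj t unfolding trajectory_iff solves_steering_def
      by (simp add: has_vector_derivative_coords_iff)
  qed (use vel t in auto)
  have const_deriv: "g' = 0"
    if "(g has_real_derivative g') (at t within {a..b})" "\<And>s. s \<in> {a..b} \<Longrightarrow> k = g s" "t \<in> {a..b}"
    for g :: "real \<Rightarrow> real" and g' k t
  proof -
    have "(g has_real_derivative 0) (at t within {a..b})"
      by (rule has_field_derivative_transform_within[OF DERIV_const zero_less_one that(3)])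
        (use that in auto)
    then show ?thesis
      using that(1,3) vector_derivative_unique_within_closed_interval[OF \<open>a < b\<close>, of t g g' 0]
      by (simp add: has_real_derivative_iff_has_vector_derivative)
  qed
  have balance: "\<mu>1 t / l1\<^sup>2 + \<mu>2 t / l2\<^sup>2 = 0" if t: "t \<in> {a..b}" for t
  proof -
    have "((\<lambda>t. \<mu>1 t / l1 * sin (\<theta>1 t) + \<mu>2 t / l2 * sin (\<theta>2 t)) has_real_derivative
        \<mu>1 t / l1 * (drag l1 (u t) (\<theta>1 t) * sin (\<theta>1 t) + steer l1 (u t) (\<theta>1 t) * cos (\<theta>1 t))
        + \<mu>2 t / l2 * (drag l2 (u t) (\<theta>2 t) * sin (\<theta>2 t) + steer l2 (u t) (\<theta>2 t) * cos (\<theta>2 t)))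
        (at t within {a..b})"
      using assms(1,2) by (auto intro!: derivative_eq_intros \<mu>[OF t] \<theta>[OF t] simp: field_simps)
    from const_deriv[OF this p(1) t]
    have "(\<mu>1 t / l1\<^sup>2 + \<mu>2 t / l2\<^sup>2) * snd (u t) = 0"
      unfolding steer_drag_sin_cos by (simp add: algebra_simps power2_eq_square)
    moreover have "((\<lambda>t. \<mu>1 t / l1 * cos (\<theta>1 t) + \<mu>2 t / l2 * cos (\<theta>2 t)) has_real_derivative
        \<mu>1 t / l1 * (drag l1 (u t) (\<theta>1 t) * cos (\<theta>1 t) - steer l1 (u t) (\<theta>1 t) * sin (\<theta>1 t))
        + \<mu>2 t / l2 * (drag l2 (u t) (\<theta>2 t) * cos (\<theta>2 t) - steer l2 (u t) (\<theta>2 t) * sin (\<theta>2 t)))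
        (at t within {a..b})"
      using assms(1,2) by (auto intro!: derivative_eq_intros \<mu>[OF t] \<theta>[OF t] simp: field_simps)
    from const_deriv[OF this p(2) t]
    have "(\<mu>1 t / l1\<^sup>2 + \<mu>2 t / l2\<^sup>2) * fst (u t) = 0"
      unfolding steer_drag_sin_cos by (simp add: algebra_simps power2_eq_square)
    moreover have "fst (u t) \<noteq> 0 \<or> snd (u t) \<noteq> 0"
      using regular[OF t] vel_eq[OF t] by (auto simp: zero_prod_def steer_def)
    ultimately show ?thesis by auto
  qed
  have "((\<lambda>t. \<mu>1 t / l1\<^sup>2 + \<mu>2 t / l2\<^sup>2) has_real_derivative
      \<mu>1 t / l1\<^sup>2 * drag l1 (u t) (\<theta>1 t) + \<mu>2 t / l2\<^sup>2 * drag l2 (u t) (\<theta>2 t)) (at t within {a..b})"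
    using assms(1,2) by (auto intro!: derivative_eq_intros \<mu>[OF t] simp: field_simps)
  then have "\<mu>1 t / l1\<^sup>2 * drag l1 (u t) (\<theta>1 t) + \<mu>2 t / l2\<^sup>2 * drag l2 (u t) (\<theta>2 t) = 0"
    by (rule const_deriv[OF _ balance[symmetric] t])
  moreover have "\<mu>2 t / l2\<^sup>2 = - (\<mu>1 t / l1\<^sup>2)"
    using balance[OF t] by linarith
  ultimately have "\<mu>1 t / l1\<^sup>2 * (drag l1 (u t) (\<theta>1 t) - drag l2 (u t) (\<theta>2 t)) = 0"
    by (simp add: algebra_simps)
  moreover have "\<mu>1 t \<noteq> 0"
    using nonzero[OF t] balance[OF t] assms(1,2) by auto
  ultimately show ?thesis
    using assms(1) by (simp add: vel_eq[OF t])
qed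

section \<open>Arc length on an interval\<close>

text \<open>The interval may be open or half-open, so the integral is taken from an arbitrary base point in it and the
derivative at \<open>t\<close> is computed in a compact subinterval that agrees with the interval near \<open>t\<close>.\<close>

lemma interval_antiderivative:
  fixes f :: "real \<Rightarrow> real"
  assumes "is_interval I" and f: "continuous_on I f"
  obtains F where "\<And>t. t \<in> I \<Longrightarrow> (F has_real_derivative f t) (at t within I)"
proof (cases "I = {}")
  case False
  then obtain m where "m \<in> I" by blast
  \<comment> \<open>One of the two integrals is over an empty or degenerate interval and vanishes.\<close>
  define F where "F = (\<lambda>t. integral {m..t} f - integral {t..m} f)"
  have "(F has_real_derivative f t) (at t within I)" if "t \<in> I" for t
  proof -
    obtain c where c: "c \<in> I" "c \<le> t" "c \<le> m" "c < t \<or> (\<forall>s\<in>I. t \<le> s)"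
    proof (cases "\<exists>s\<in>I. s < t")
      case True
      then obtain s where "s \<in> I" "s < t" by blast
      then show thesis using \<open>m \<in> I\<close> by (intro that[of "min s m"]) (auto simp: min_def)
    next
      case False
      then show thesis using \<open>t \<in> I\<close> \<open>m \<in> I\<close> by (intro that[of t]) (auto simp: not_less)
    qed
    obtain d where d: "d \<in> I" "t \<le> d" "m \<le> d" "t < d \<or> (\<forall>s\<in>I. s \<le> t)"
    proof (cases "\<exists>s\<in>I. t < s")
      case True
      then obtain s where "s \<in> I" "t < s" by blast
      then show thesis using \<open>m \<in> I\<close> by (intro that[of "max s m"]) (auto simp: max_def)
    next
      case False
      then show thesis using \<open>t \<in> I\<close> \<open>m \<in> I\<close> by (intro that[of t]) (auto simp: not_less)
    qed
    have "{c..d} \<subseteq> I"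
      using \<open>is_interval I\<close> c d unfolding is_interval_1 by (meson atLeastAtMost_iff subsetI)
    then have f_cd: "continuous_on {c..d} f"
      using f continuous_on_subset by blast
    have F_cd: "integral {c..s} f - integral {c..m} f = F s" if "s \<in> {c..d}" for s
    proof (cases s m rule: linorder_le_cases)
      case le
      have "integral {c..s} f + integral {s..m} f = integral {c..m} f"
        using that le d f_cd
        by (intro Henstock_Kurzweil_Integration.integral_combine integrable_continuous_real)
          (auto elim: continuous_on_subset)
      moreover have "integral {m..s} f = 0"
        using le by (cases "m = s") auto
      ultimately show ?thesis by (simp add: F_def)
    next
      case ge
      have "integral {c..m} f + integral {m..s} f = integral {c..s} f"
        using that ge c f_cd
        by (intro Henstock_Kurzweil_Integration.integral_combine integrable_continuous_real)
          (auto elim: continuous_on_subset)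
      moreover have "integral {s..m} f = 0"
        using ge by (cases "m = s") auto
      ultimately show ?thesis by (simp add: F_def)
    qed
    have t: "t \<in> {c..d}" using c d by simp
    have "((\<lambda>s. integral {c..s} f - integral {c..m} f) has_real_derivative f t - 0) (at t within {c..d})"
      by (intro derivative_intros integral_has_real_derivative f_cd t)
    then have F_deriv: "(F has_real_derivative f t) (at t within {c..d})"
      using has_field_derivative_transform_within[OF _ zero_less_one t, where g = F] F_cd by simp
    define U where "U = (if c < t then {c<..} else UNIV) \<inter> (if t < d then {..<d} else UNIV)"
    have "I \<inter> U - {t} = {c..d} \<inter> U - {t}"
      using \<open>{c..d} \<subseteq> I\<close> c(4) d(4)
      by (auto simp: U_def) (use c(2) d(2) in \<open>meson order_trans\<close>)+
    then have "at t within I = at t within {c..d}"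
      using at_within_nhd[of t U I "{c..d}"] by (auto simp: U_def open_Int)
    then show ?thesis using F_deriv by simp
  qed
  then show thesis by (rule that)
qed (use that in auto)

lemma interval_inverse_derivative:
  fixes \<sigma> S :: "real \<Rightarrow> real"
  assumes "is_interval I"
    and \<sigma>: "\<And>t. t \<in> I \<Longrightarrow> (\<sigma> has_real_derivative S t) (at t within I)"
    and S: "\<And>t. t \<in> I \<Longrightarrow> S t > 0"
  obtains g where "\<And>t. t \<in> I \<Longrightarrow> g (\<sigma> t) = t"
    "\<And>t. t \<in> I \<Longrightarrow> (g has_real_derivative 1 / S t) (at (\<sigma> t) within \<sigma> ` I)"
proof -
  have cont: "continuous_on I \<sigma>"
    using \<sigma> by (meson DERIV_continuous continuous_on_eq_continuous_within)
  have "\<sigma> s < \<sigma> t" if "s \<in> I" "t \<in> I" "s < t" for s t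
  proof -
    have sub: "{s..t} \<subseteq> I"
      using \<open>is_interval I\<close> that unfolding is_interval_1 by (meson atLeastAtMost_iff subsetI)
    show ?thesis
    proof (rule DERIV_pos_imp_increasing_open[OF \<open>s < t\<close>])
      show "continuous_on {s..t} \<sigma>" using cont sub by (rule continuous_on_subset)
      show "\<exists>y. DERIV \<sigma> r :> y \<and> y > 0" if "s < r" "r < t" for r
      proof -
        have "r \<in> I" using that sub by auto
        then have "(\<sigma> has_real_derivative S r) (at r within {s..t})"
          using \<sigma> sub DERIV_subset by blast
        then show ?thesis
          using at_within_Icc_at[OF that] S[OF \<open>r \<in> I\<close>] by auto
      qed
    qed
  qed
  then have "inj_on \<sigma> I"
    by (metis (full_types) inj_onI less_irrefl linorder_neqE_linordered_idom)
  moreover have "path_connected I"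
    using \<open>is_interval I\<close> by (simp add: is_interval_path_connected)
  ultimately obtain g where "homeomorphism I (\<sigma> ` I) \<sigma> g"
    using injective_into_1d_eq_homeomorphism[OF cont] by blast
  then have inv: "\<And>t. t \<in> I \<Longrightarrow> g (\<sigma> t) = t" and g_cont: "continuous_on (\<sigma> ` I) g"
    by (auto simp: homeomorphism_def)
  have "(g has_real_derivative 1 / S t) (at (\<sigma> t) within \<sigma> ` I)" if "t \<in> I" for t
    unfolding has_field_derivative_def
  proof (rule has_derivative_inverse_within[where f' = "(*) (S t)"])
    show "(\<sigma> has_derivative (*) (S t)) (at t within I)"
      using \<sigma>[OF that] by (simp add: has_field_derivative_def)
    show "continuous (at (\<sigma> t) within \<sigma> ` I) g"
      using g_cont that by (simp add: continuous_on_eq_continuous_within)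
    show "linear ((*) (1 / S t))"
      by (intro bounded_linear.linear bounded_linear_mult_right)
    show "(*) (1 / S t) \<circ> (*) (S t) = id"
      using S[OF that] by (auto simp: fun_eq_iff)
  qed (use that inv in auto)
  with inv show thesis by (rule that)
qed

section \<open>Curves with equal drags are elastic\<close>

text \<open>Let \<open>T\<close> be the unit tangent, \<open>a1\<close> and \<open>a2\<close> the angular velocities and \<open>b\<close> the common drag, all with
respect to arc length. The vector \<open>w = e1 / l1 - e2 / l2\<close> is orthogonal to \<open>T\<close> and never vanishes because
\<open>l1 \<noteq> l2\<close>, so \<open>T\<close> is as smooth as the angles although the velocity is only continuous. Differentiating
\<open>w \<bullet> T = 0\<close> gives \<open>a1\<^sup>2 - a2\<^sup>2 = \<kappa> (a1 - a2)\<close> with \<open>a1 - a2 \<noteq> 0\<close>: the curvature is \<open>\<kappa> = a1 + a2\<close>. Then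
\<open>ai' = b (\<kappa> - ai)\<close> and \<open>b' = - a1 a2\<close>, hence \<open>\<kappa>' = b \<kappa>\<close> and \<open>\<kappa>'' = \<kappa> (b\<^sup>2 - a1 a2)\<close>. Finally
\<open>ai\<^sup>2 + b\<^sup>2 = 1 / li\<^sup>2\<close>, because these are the components of \<open>T\<close> in an orthonormal frame divided by \<open>li\<close>,
and this turns \<open>b\<^sup>2 - a1 a2\<close> into \<open>(1 / l1\<^sup>2 + 1 / l2\<^sup>2) / 2 - \<kappa>\<^sup>2 / 2\<close>.

Derivatives are first taken in the given parameter, where each acquires the factor \<open>S\<close>, the speed.\<close>

lemma elastic_of_equal_drag:
  assumes "l1 > 0" "l2 > 0" "l1 \<noteq> l2" "is_interval I"
    and u: "continuous_on I u" and u_nonzero: "\<And>t. t \<in> I \<Longrightarrow> u t \<noteq> 0"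
    and x: "\<And>t. t \<in> I \<Longrightarrow> (x has_real_derivative fst (u t)) (at t within I)"
    and y: "\<And>t. t \<in> I \<Longrightarrow> (y has_real_derivative snd (u t)) (at t within I)"
    and \<theta>1: "\<And>t. t \<in> I \<Longrightarrow> (\<theta>1 has_real_derivative steer l1 (u t) (\<theta>1 t)) (at t within I)"
    and \<theta>2: "\<And>t. t \<in> I \<Longrightarrow> (\<theta>2 has_real_derivative steer l2 (u t) (\<theta>2 t)) (at t within I)"
    and drag_eq: "\<And>t. t \<in> I \<Longrightarrow> drag l1 (u t) (\<theta>1 t) = drag l2 (u t) (\<theta>2 t)"
  shows "elastic_curve I (\<lambda>t. (x t, y t))"
proof -
  define S where "S = (\<lambda>t. norm (u t))"
  define T1 T2 where "T1 = (\<lambda>t. fst (u t) / S t)" and "T2 = (\<lambda>t. snd (u t) / S t)"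
  define a1 a2 where "a1 = (\<lambda>t. steer l1 (T1 t, T2 t) (\<theta>1 t))"
    and "a2 = (\<lambda>t. steer l2 (T1 t, T2 t) (\<theta>2 t))"
  define b where "b = (\<lambda>t. drag l1 (T1 t, T2 t) (\<theta>1 t))"
  define w1 w2 where "w1 = (\<lambda>t. cos (\<theta>1 t) / l1 - cos (\<theta>2 t) / l2)"
    and "w2 = (\<lambda>t. sin (\<theta>1 t) / l1 - sin (\<theta>2 t) / l2)"
  define d where "d = (\<lambda>t. a1 t - a2 t)"
  define \<kappa> where "\<kappa> = (\<lambda>t. a1 t + a2 t)"
  have S_pos: "S t > 0" if "t \<in> I" for t
    using u_nonzero[OF that] by (simp add: S_def)
  have u_eq: "fst (u t) = S t * T1 t" "snd (u t) = S t * T2 t" if "t \<in> I" for t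
    using S_pos[OF that] by (auto simp: T1_def T2_def)
  have T_unit: "(T1 t)\<^sup>2 + (T2 t)\<^sup>2 = 1" if "t \<in> I" for t
  proof -
    have "(fst (u t))\<^sup>2 + (snd (u t))\<^sup>2 = (S t)\<^sup>2"
      by (cases "u t") (simp add: S_def norm_Pair)
    then show ?thesis
      using S_pos[OF that] by (simp add: T1_def T2_def power_divide flip: add_divide_distrib)
  qed
  have steer_u: "steer l (u t) \<alpha> = S t * steer l (T1 t, T2 t) \<alpha>"
    and drag_u: "drag l (u t) \<alpha> = S t * drag l (T1 t, T2 t) \<alpha>" if "t \<in> I" for t l \<alpha>
    by (simp_all add: steer_def drag_def u_eq[OF that] algebra_simps)
  have b_eq: "b t = drag l2 (T1 t, T2 t) (\<theta>2 t)" if "t \<in> I" for t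
    using drag_eq[OF that] S_pos[OF that] by (simp add: drag_u that b_def)
  have \<theta>_deriv: "(\<theta>1 has_real_derivative S t * a1 t) (at t within I)"
    "(\<theta>2 has_real_derivative S t * a2 t) (at t within I)" if "t \<in> I" for t
    using \<theta>1[OF that] \<theta>2[OF that] by (simp_all add: steer_u that a1_def a2_def)
  \<comment> \<open>Being orthogonal to the unit vector \<open>T\<close>, the vector \<open>w\<close> is \<open>- d\<close> times \<open>T\<close> rotated by a right angle.\<close>
  have w_eq: "w1 t = d t * T2 t" "w2 t = - d t * T1 t" if "t \<in> I" for t
  proof -
    have orth: "w1 t * T1 t + w2 t * T2 t = 0"
      using b_eq[OF that] by (simp add: b_def drag_def w1_def w2_def algebra_simps
          add_divide_distrib diff_divide_distrib)
    have d: "d t = w1 t * T2 t - w2 t * T1 t"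
      by (simp add: d_def a1_def a2_def steer_def w1_def w2_def algebra_simps
          add_divide_distrib diff_divide_distrib)
    show "w1 t = d t * T2 t" "w2 t = - d t * T1 t"
      using orth d T_unit[OF that] by algebra+
  qed
  have d_sq: "(d t)\<^sup>2 = (w1 t)\<^sup>2 + (w2 t)\<^sup>2" if "t \<in> I" for t
    using w_eq[OF that] T_unit[OF that] by algebra
  have d_nonzero: "d t \<noteq> 0" if "t \<in> I" for t
  proof
    assume "d t = 0"
    then have "cos (\<theta>1 t) / l1 = cos (\<theta>2 t) / l2" "sin (\<theta>1 t) / l1 = sin (\<theta>2 t) / l2"
      using w_eq[OF that] by (auto simp: w1_def w2_def)
    then have "(cos (\<theta>1 t))\<^sup>2 / l1\<^sup>2 + (sin (\<theta>1 t))\<^sup>2 / l1\<^sup>2 = (cos (\<theta>2 t))\<^sup>2 / l2\<^sup>2 + (sin (\<theta>2 t))\<^sup>2 / l2\<^sup>2"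
      by (metis power_divide)
    then have "1 / l1\<^sup>2 = 1 / l2\<^sup>2"
      by (simp flip: add_divide_distrib)
    then show False
      using assms(1-3) by (simp add: power2_eq_iff)
  qed
  have \<theta>_cont [continuous_intros]: "continuous_on I \<theta>1" "continuous_on I \<theta>2"
    using \<theta>1 \<theta>2 by (meson DERIV_continuous continuous_on_eq_continuous_within)+
  have S_cont: "continuous_on I S"
    unfolding S_def by (intro continuous_intros u)
  have d_cont: "continuous_on I d"
    unfolding d_def a1_def a2_def steer_def T1_def T2_def fst_conv snd_conv
    by (intro continuous_intros u S_cont) (use S_pos assms in force)+
  \<comment> \<open>The sign of \<open>d\<close> is constant, so \<open>d\<close> is a constant multiple of the norm of \<open>w\<close> and differentiable.\<close>
  have "connected (d ` I)"
    using d_cont \<open>is_interval I\<close> by (simp add: connected_continuous_image is_interval_connected)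
  then have "(\<forall>t\<in>I. d t > 0) \<or> (\<forall>t\<in>I. d t < 0)"
    using d_nonzero connectedD_interval[of "d ` I"]
    by (smt (verit, best) imageE imageI)
  then obtain \<eta> :: real where "\<eta>\<^sup>2 = 1" and \<eta>: "\<And>t. t \<in> I \<Longrightarrow> d t = \<eta> * sqrt ((w1 t)\<^sup>2 + (w2 t)\<^sup>2)"
  proof
    assume "\<forall>t\<in>I. d t > 0"
    then show thesis
      by (intro that[of 1]) (auto simp: simp flip: d_sq)
  next
    assume "\<forall>t\<in>I. d t < 0"
    then show thesis
      by (intro that[of "- 1"]) (auto simp: simp flip: d_sq)
  qed
  have T_deriv: "(T1 has_real_derivative S t * (- \<kappa> t * T2 t)) (at t within I)"
    "(T2 has_real_derivative S t * (\<kappa> t * T1 t)) (at t within I)" if t: "t \<in> I" for t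
  proof -
    define w1' w2' where "w1' = S t * (- sin (\<theta>1 t) / l1 * a1 t + sin (\<theta>2 t) / l2 * a2 t)"
      and "w2' = S t * (cos (\<theta>1 t) / l1 * a1 t - cos (\<theta>2 t) / l2 * a2 t)"
    have w1_deriv: "(w1 has_real_derivative w1') (at t within I)"
      unfolding w1_def w1'_def using assms(1,2)
      by (auto intro!: derivative_eq_intros \<theta>_deriv[OF t] simp: field_simps)
    have w2_deriv: "(w2 has_real_derivative w2') (at t within I)"
      unfolding w2_def w2'_def using assms(1,2)
      by (auto intro!: derivative_eq_intros \<theta>_deriv[OF t] simp: field_simps)
    define N where "N = (\<lambda>t. (w1 t)\<^sup>2 + (w2 t)\<^sup>2)"
    have "N t > 0"
      using d_sq[OF t] d_nonzero[OF t] unfolding N_def by (metis zero_less_power2)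
    have N_deriv: "(N has_real_derivative 2 * (w1 t * w1' + w2 t * w2')) (at t within I)"
      unfolding N_def by (auto intro!: derivative_eq_intros w1_deriv w2_deriv)
    have "((\<lambda>t. \<eta> * sqrt (N t)) has_real_derivative
        \<eta> * (inverse (sqrt (N t)) / 2 * (2 * (w1 t * w1' + w2 t * w2')))) (at t within I)"
      by (rule DERIV_cmult)
        (rule DERIV_chain2[where g = N, OF DERIV_real_sqrt[OF \<open>N t > 0\<close>] N_deriv])
    moreover have "\<eta> * inverse (sqrt (N t)) = 1 / d t"
    proof -
      have "\<eta> * d t = sqrt (N t)"
        using \<eta>[OF t] \<open>\<eta>\<^sup>2 = 1\<close> unfolding N_def by algebra
      moreover have "sqrt (N t) \<noteq> 0" using \<open>N t > 0\<close> by simp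
      ultimately show ?thesis using d_nonzero[OF t] by (simp add: field_simps)
    qed
    then have "\<eta> * (inverse (sqrt (N t)) / 2 * (2 * X)) = X / d t" for X
      by (simp flip: mult.assoc)
    ultimately have "((\<lambda>t. \<eta> * sqrt (N t)) has_real_derivative (w1 t * w1' + w2 t * w2') / d t)
        (at t within I)"
      by (simp only:)
    then have d_deriv: "(d has_real_derivative (w1 t * w1' + w2 t * w2') / d t) (at t within I)"
      by (rule has_field_derivative_transform_within[OF _ zero_less_one t]) (simp add: \<eta> N_def)
    have turn: "T1 t * w1' + T2 t * w2' = S t * \<kappa> t * d t"
    proof -
      have "T1 t * w1' + T2 t * w2' = S t * (a1 t * a1 t - a2 t * a2 t)"
        by (simp add: w1'_def w2'_def a1_def a2_def steer_def algebra_simps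
            add_divide_distrib diff_divide_distrib)
      then show ?thesis by (simp add: \<kappa>_def d_def algebra_simps)
    qed
    have "((\<lambda>t. - w2 t / d t) has_real_derivative
        (- w2' * d t - - w2 t * ((w1 t * w1' + w2 t * w2') / d t)) / (d t * d t)) (at t within I)"
      by (intro DERIV_divide DERIV_minus w2_deriv d_deriv d_nonzero[OF t])
    moreover have "(- w2' * d t - - w2 t * ((w1 t * w1' + w2 t * w2') / d t)) / (d t * d t)
        = S t * (- \<kappa> t * T2 t)"
    proof -
      have "(w1 t * w1' + w2 t * w2') / d t = T2 t * w1' - T1 t * w2'"
        using d_nonzero[OF t] by (simp add: w_eq[OF t] field_simps)
      moreover have "- w2' * d t - - w2 t * (T2 t * w1' - T1 t * w2') = S t * (- \<kappa> t * T2 t) * (d t * d t)"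
        using turn w_eq[OF t] T_unit[OF t] by algebra
      ultimately show ?thesis using d_nonzero[OF t] by simp
    qed
    ultimately have "((\<lambda>t. - w2 t / d t) has_real_derivative S t * (- \<kappa> t * T2 t)) (at t within I)"
      by (simp only:)
    then show "(T1 has_real_derivative S t * (- \<kappa> t * T2 t)) (at t within I)"
      by (rule has_field_derivative_transform_within[OF _ zero_less_one t])
        (simp add: w_eq d_nonzero)
    have "((\<lambda>t. w1 t / d t) has_real_derivative
        (w1' * d t - w1 t * ((w1 t * w1' + w2 t * w2') / d t)) / (d t * d t)) (at t within I)"
      by (intro DERIV_divide w1_deriv d_deriv d_nonzero[OF t])
    moreover have "(w1' * d t - w1 t * ((w1 t * w1' + w2 t * w2') / d t)) / (d t * d t)
        = S t * (\<kappa> t * T1 t)"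
    proof -
      have "(w1 t * w1' + w2 t * w2') / d t = T2 t * w1' - T1 t * w2'"
        using d_nonzero[OF t] by (simp add: w_eq[OF t] field_simps)
      moreover have "w1' * d t - w1 t * (T2 t * w1' - T1 t * w2') = S t * (\<kappa> t * T1 t) * (d t * d t)"
        using turn w_eq[OF t] T_unit[OF t] by algebra
      ultimately show ?thesis using d_nonzero[OF t] by simp
    qed
    ultimately have "((\<lambda>t. w1 t / d t) has_real_derivative S t * (\<kappa> t * T1 t)) (at t within I)"
      by (simp only:)
    then show "(T2 has_real_derivative S t * (\<kappa> t * T1 t)) (at t within I)"
      by (rule has_field_derivative_transform_within[OF _ zero_less_one t])
        (simp add: w_eq d_nonzero)
  qed
  have a1_deriv: "(a1 has_real_derivative S t * (b t * (\<kappa> t - a1 t))) (at t within I)" if t: "t \<in> I" for t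
    unfolding a1_def b_def drag_def steer_def fst_conv snd_conv using assms(1)
    by (auto intro!: derivative_eq_intros \<theta>_deriv[OF t] T_deriv[OF t]
        simp: field_simps a1_def[unfolded steer_def])
  have a2_deriv: "(a2 has_real_derivative S t * (b t * (\<kappa> t - a2 t))) (at t within I)" if t: "t \<in> I" for t
    unfolding b_eq[OF t] a2_def drag_def steer_def fst_conv snd_conv using assms(2)
    by (auto intro!: derivative_eq_intros \<theta>_deriv[OF t] T_deriv[OF t]
        simp: field_simps a2_def[unfolded steer_def])
  have b_deriv: "(b has_real_derivative S t * (- a1 t * a2 t)) (at t within I)" if t: "t \<in> I" for t
  proof -
    have "(b has_real_derivative S t * (a1 t * (a1 t - \<kappa> t))) (at t within I)"
      unfolding b_def drag_def fst_conv snd_conv using assms(1)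
      by (auto intro!: derivative_eq_intros \<theta>_deriv[OF t] T_deriv[OF t]
          simp: field_simps a1_def steer_def)
    then show ?thesis by (simp add: \<kappa>_def)
  qed
  have \<kappa>_deriv: "(\<kappa> has_real_derivative S t * (b t * \<kappa> t)) (at t within I)" if t: "t \<in> I" for t
    unfolding \<kappa>_def
    by (auto intro!: derivative_eq_intros a1_deriv[OF t] a2_deriv[OF t] simp: \<kappa>_def algebra_simps)
  have b\<kappa>_deriv: "((\<lambda>t. b t * \<kappa> t) has_real_derivative S t * (\<kappa> t * ((b t)\<^sup>2 - a1 t * a2 t))) (at t within I)"
    if t: "t \<in> I" for t
    by (auto intro!: derivative_eq_intros b_deriv[OF t] \<kappa>_deriv[OF t] simp: algebra_simps power2_eq_square)
  have elastica: "\<kappa> t * ((b t)\<^sup>2 - a1 t * a2 t) + 1 / 2 * \<kappa> t ^ 3 + - (1 / l1\<^sup>2 + 1 / l2\<^sup>2) / 2 * \<kappa> t = 0"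
    if t: "t \<in> I" for t
  proof -
    have frame: "(steer l (T1 t, T2 t) \<alpha>)\<^sup>2 + (drag l (T1 t, T2 t) \<alpha>)\<^sup>2 = 1 / l\<^sup>2" for l \<alpha>
    proof -
      have "(- sin \<alpha> * T1 t + cos \<alpha> * T2 t)\<^sup>2 + (cos \<alpha> * T1 t + sin \<alpha> * T2 t)\<^sup>2 = 1"
        using T_unit[OF t] sin_cos_squared_add[of \<alpha>] by algebra
      then show ?thesis
        by (simp add: steer_def drag_def power_divide flip: add_divide_distrib)
    qed
    have curvatures: "1 / l1\<^sup>2 = (a1 t)\<^sup>2 + (b t)\<^sup>2" "1 / l2\<^sup>2 = (a2 t)\<^sup>2 + (b t)\<^sup>2"
      using frame[of l1 "\<theta>1 t"] frame[of l2 "\<theta>2 t"] b_eq[OF t] by (simp_all add: a1_def a2_def b_def)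
    show ?thesis
      unfolding curvatures \<kappa>_def by (simp add: field_simps power2_eq_square power3_eq_cube)
  qed
  obtain \<sigma> where \<sigma>: "\<And>t. t \<in> I \<Longrightarrow> (\<sigma> has_real_derivative S t) (at t within I)"
    by (rule interval_antiderivative[OF \<open>is_interval I\<close> S_cont]) blast
  obtain g where g: "\<And>t. t \<in> I \<Longrightarrow> g (\<sigma> t) = t"
    and g_deriv: "\<And>t. t \<in> I \<Longrightarrow> (g has_real_derivative 1 / S t) (at (\<sigma> t) within \<sigma> ` I)"
    by (rule interval_inverse_derivative[OF \<open>is_interval I\<close> \<sigma> S_pos]) (assumption | rule that; blast)+
  \<comment> \<open>Passing to arc length removes the factor \<open>S\<close>.\<close>
  have arclength_deriv: "((\<lambda>s. f (g s)) has_real_derivative f' (g s)) (at s within \<sigma> ` I)"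
    if f: "\<And>t. t \<in> I \<Longrightarrow> (f has_real_derivative S t * f' t) (at t within I)" and s: "s \<in> \<sigma> ` I"
    for f f' :: "real \<Rightarrow> real" and s
  proof -
    obtain t where t: "t \<in> I" "s = \<sigma> t" using s by blast
    have "g ` \<sigma> ` I = I" using g by force
    then have "(f has_real_derivative S t * f' t) (at (g s) within g ` \<sigma> ` I)"
      using f[OF t(1)] g[OF t(1)] t(2) by simp
    from DERIV_image_chain[OF this, of "1 / S t"]
    show ?thesis
      using g_deriv[OF t(1)] S_pos[OF t(1)] g[OF t(1)] t(2) by (simp add: o_def)
  qed
  have "arc_length_reparam I (\<lambda>t. (x t, y t)) \<sigma> (\<lambda>s. (x (g s), y (g s)))"
    unfolding arc_length_reparam_def
  proof (intro ballI conjI exI)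
    fix t assume t: "t \<in> I"
    show "(x t, y t) = (x (g (\<sigma> t)), y (g (\<sigma> t)))" by (simp add: g[OF t])
    show "u t \<noteq> 0" using u_nonzero[OF t] .
    show "((\<lambda>t. (x t, y t)) has_vector_derivative u t) (at t within I)"
      using has_vector_derivative_Pair[of x "fst (u t)" t I y "snd (u t)"] x[OF t] y[OF t]
      by (simp add: has_real_derivative_iff_has_vector_derivative)
    show "(\<sigma> has_real_derivative norm (u t)) (at t within I)"
      using \<sigma>[OF t] by (simp add: S_def)
  qed
  moreover have "unit_speed_curvature (\<sigma> ` I) (\<lambda>s. (x (g s), y (g s))) (\<lambda>s. \<kappa> (g s))"
    unfolding unit_speed_curvature_def
  proof (intro exI ballI conjI)
    fix s assume s: "s \<in> \<sigma> ` I"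
    then have "g s \<in> I" using g by auto
    have x': "(x has_real_derivative S t * T1 t) (at t within I)"
      and y': "(y has_real_derivative S t * T2 t) (at t within I)" if "t \<in> I" for t
      using x[OF that] y[OF that] by (simp_all add: u_eq that)
    show "((\<lambda>s. (x (g s), y (g s))) has_vector_derivative (T1 (g s), T2 (g s))) (at s within \<sigma> ` I)"
      using arclength_deriv[of x T1, OF x' s] arclength_deriv[of y T2, OF y' s]
      by (intro has_vector_derivative_Pair)
        (auto simp: has_real_derivative_iff_has_vector_derivative)
    show "norm (T1 (g s), T2 (g s)) = 1"
      using T_unit[OF \<open>g s \<in> I\<close>] by (simp add: norm_Pair)
    have "((\<lambda>s. (T1 (g s), T2 (g s))) has_vector_derivative
        (- \<kappa> (g s) * T2 (g s), \<kappa> (g s) * T1 (g s))) (at s within \<sigma> ` I)"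
      using arclength_deriv[OF T_deriv(1) s] arclength_deriv[OF T_deriv(2) s]
      by (intro has_vector_derivative_Pair)
        (auto simp: has_real_derivative_iff_has_vector_derivative)
    then show "((\<lambda>s. (T1 (g s), T2 (g s))) has_vector_derivative
        \<kappa> (g s) *\<^sub>R rot90 (T1 (g s), T2 (g s))) (at s within \<sigma> ` I)"
      by (simp add: rot90_def)
  qed
  moreover have "\<forall>s\<in>\<sigma> ` I.
      ((\<lambda>s. \<kappa> (g s)) has_real_derivative b (g s) * \<kappa> (g s)) (at s within \<sigma> ` I) \<and>
      ((\<lambda>s. b (g s) * \<kappa> (g s)) has_real_derivative
        \<kappa> (g s) * ((b (g s))\<^sup>2 - a1 (g s) * a2 (g s))) (at s within \<sigma> ` I) \<and>
      \<kappa> (g s) * ((b (g s))\<^sup>2 - a1 (g s) * a2 (g s)) + 1 / 2 * \<kappa> (g s) ^ 3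
        + - (1 / l1\<^sup>2 + 1 / l2\<^sup>2) / 2 * \<kappa> (g s) = 0"
  proof (intro ballI conjI)
    fix s assume s: "s \<in> \<sigma> ` I"
    show "((\<lambda>s. \<kappa> (g s)) has_real_derivative b (g s) * \<kappa> (g s)) (at s within \<sigma> ` I)"
      using \<kappa>_deriv s by (rule arclength_deriv)
    show "((\<lambda>s. b (g s) * \<kappa> (g s)) has_real_derivative
        \<kappa> (g s) * ((b (g s))\<^sup>2 - a1 (g s) * a2 (g s))) (at s within \<sigma> ` I)"
      using b\<kappa>_deriv s by (rule arclength_deriv)
    show "\<kappa> (g s) * ((b (g s))\<^sup>2 - a1 (g s) * a2 (g s)) + 1 / 2 * \<kappa> (g s) ^ 3
        + - (1 / l1\<^sup>2 + 1 / l2\<^sup>2) / 2 * \<kappa> (g s) = 0"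
      using s g by (intro elastica) auto
  qed
  ultimately show ?thesis
    unfolding elastic_curve_def by (intro exI conjI)
qed

lemma elastic_curve_cong:
  assumes "\<And>t. t \<in> I \<Longrightarrow> c t = c' t" "elastic_curve I c"
  shows "elastic_curve I c'"
proof -
  have "arc_length_reparam I c' \<sigma> y" if "arc_length_reparam I c \<sigma> y" for \<sigma> y
    unfolding arc_length_reparam_def
  proof
    fix t assume t: "t \<in> I"
    have "(c' has_vector_derivative v) (at t within I)"
      if "(c has_vector_derivative v) (at t within I)" for v
      using has_vector_derivative_transform_within[OF that zero_less_one t] assms(1) by blast
    then show "c' t = y (\<sigma> t) \<and> (\<exists>v. v \<noteq> 0 \<and> (c' has_vector_derivative v) (at t within I) \<and>
        (\<sigma> has_real_derivative norm v) (at t within I))"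
      using that t assms(1) unfolding arc_length_reparam_def by metis
  qed
  then show ?thesis
    using assms(2) unfolding elastic_curve_def by meson
qed

section \<open>Singular curves\<close>

lemma in_distr_iff:
  "q' \<in> distr l1 l2 (x, y, \<theta>1, \<theta>2) \<longleftrightarrow>
    (\<exists>u. q' = (fst u, snd u, steer l1 u \<theta>1, steer l2 u \<theta>2))"
proof -
  have "q' \<in> distr l1 l2 (x, y, \<theta>1, \<theta>2) \<longleftrightarrow>
      (\<exists>u1 u2. q' = u1 *\<^sub>R v1 l1 l2 (x, y, \<theta>1, \<theta>2) + u2 *\<^sub>R v2 l1 l2 (x, y, \<theta>1, \<theta>2))"
    by (auto simp: distr_def span_breakdown_eq algebra_simps)
  then show ?thesis
    unfolding frame_combination by auto
qed

theorem proposition4p2: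
  fixes l1 l2 :: real and I :: "real set" and c :: "real \<Rightarrow> config"
  assumes "l1 > 0" and "l2 > 0" and "l1 \<noteq> l2"
    and "is_interval I" and "interior I \<noteq> {}"
    and "c ` I \<subseteq> config_space"
    and "singular_curve l1 l2 I c"
  shows "elastic_curve I (x_proj \<circ> c)"
proof -
  obtain q where c: "\<And>t. t \<in> I \<Longrightarrow> c t = of_coords (q t)" and "regular_horizontal l1 l2 I q"
    and crit: "\<And>s t. s \<in> I \<Longrightarrow> t \<in> I \<Longrightarrow> s < t \<Longrightarrow>
      \<exists>a\<in>I. \<exists>b\<in>I. a \<le> s \<and> t \<le> b \<and> critical_arc l1 l2 a b q"
    using \<open>singular_curve l1 l2 I c\<close> unfolding singular_curve_def by blast
  obtain x y \<theta>1 \<theta>2 where q: "q = (\<lambda>t. (x t, y t, \<theta>1 t, \<theta>2 t))"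
    by (rule coords_curve_cases)
  obtain q' where q'_cont: "continuous_on I q'"
    and q': "\<And>t. t \<in> I \<Longrightarrow> (q has_vector_derivative q' t) (at t within I)"
    and q'_nonzero: "\<And>t. t \<in> I \<Longrightarrow> q' t \<noteq> 0"
    and q'_distr: "\<And>t. t \<in> I \<Longrightarrow> q' t \<in> distr l1 l2 (q t)"
    using \<open>regular_horizontal l1 l2 I q\<close> unfolding regular_horizontal_def by blast
  define u where "u = (\<lambda>t. (fst (q' t), fst (snd (q' t))))"
  have q'_eq: "q' t = (fst (u t), snd (u t), steer l1 (u t) (\<theta>1 t), steer l2 (u t) (\<theta>2 t))"
    if t: "t \<in> I" for t
    using q'_distr[OF t] unfolding q in_distr_iff by (auto simp: u_def)
  have derivs: "(x has_real_derivative fst (u t)) (at t within I)"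
    "(y has_real_derivative snd (u t)) (at t within I)"
    "(\<theta>1 has_real_derivative steer l1 (u t) (\<theta>1 t)) (at t within I)"
    "(\<theta>2 has_real_derivative steer l2 (u t) (\<theta>2 t)) (at t within I)" if t: "t \<in> I" for t
    using q'[OF t] unfolding q q'_eq[OF t] has_vector_derivative_coords_iff by auto
  have u_nonzero: "u t \<noteq> 0" if t: "t \<in> I" for t
    using q'_nonzero[OF t] q'_eq[OF t] by (auto simp: steer_def zero_prod_def)
  have drag_eq: "drag l1 (u t) (\<theta>1 t) = drag l2 (u t) (\<theta>2 t)" if t: "t \<in> I" for t
  proof -
    \<comment> \<open>A second point of the interval, so that a critical arc passes through \<open>t\<close>.\<close>
    obtain s where "s \<in> I" "s \<noteq> t"
    proof -
      obtain z e where "e > 0" "ball z e \<subseteq> I"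
        using \<open>interior I \<noteq> {}\<close> by (auto simp: mem_interior)
      then have "z \<in> I" "z + e / 2 \<in> I"
        by (auto simp: subset_iff dist_norm)
      with \<open>e > 0\<close> show thesis
        using that[of z] that[of "z + e / 2"] by (cases "z = t") auto
    qed
    then have "min s t \<in> I" "max s t \<in> I" "min s t < max s t"
      using t by (auto simp: min_def max_def)
    from crit[OF this] obtain a b where ab: "a \<in> I" "b \<in> I" "a \<le> min s t" "max s t \<le> b" "critical_arc l1 l2 a b q"
      by blast
    then have "a < b" "t \<in> {a..b}"
      using \<open>s \<noteq> t\<close> by auto
    have sub: "{a..b} \<subseteq> I"
      using \<open>is_interval I\<close> ab unfolding is_interval_1 by (meson atLeastAtMost_iff subsetI)
    show ?thesis
      unfolding u_def
    proof (rule critical_arc_drag_eq[OF assms(1,2) \<open>a < b\<close> _ _ _ \<open>t \<in> {a..b}\<close>])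
      show "critical_arc l1 l2 a b (\<lambda>t. (x t, y t, \<theta>1 t, \<theta>2 t))"
        using ab(5) by (simp add: q)
      show "((\<lambda>t. (x t, y t, \<theta>1 t, \<theta>2 t)) has_vector_derivative q' t) (at t within {a..b})"
        if "t \<in> {a..b}" for t
        using has_vector_derivative_within_subset[OF q' sub] that sub by (auto simp: q)
      show "q' t \<noteq> 0" if "t \<in> {a..b}" for t
        using q'_nonzero that sub by blast
    qed
  qed
  have "continuous_on I u"
    unfolding u_def by (intro continuous_intros q'_cont)
  then have "elastic_curve I (\<lambda>t. (x t, y t))"
    by (rule elastic_of_equal_drag[OF assms(1-4)]) (fact u_nonzero derivs drag_eq)+
  then show ?thesis
    by (rule elastic_curve_cong[rotated]) (simp add: c q of_coords_def x_proj_def)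
qed

end
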